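(* Let $\ell:\mathbb{N}\to\mathbb{N}$ be a function for which there are $c>0$ and $n_0\in\mathbb{N}$ with $c\log n\le \ell(n)\le n$ for all $n\ge n_0$. Then there is no compact family of extended formulations for the polytopes $\mathrm{P}_{\mathrm{cycl}}^{\ell(n)}(n)$, $n\ge n_0$, in which each formulation is symmetric with respect to the group $\mathfrak{S}(n)$ acting by permuting the nodes of $K_n$.
   Context: $K_n=([n],E_n)$ is the complete graph on $[n]=\{1,\dots,n\}$. $\mathcal{C}^{\ell}(n)$ is the set of all (edge sets of) simple cycles $C\subseteq E_n$ of length $|C|=\ell$ in $K_n$; $\chi(C)\in\{0,1\}^{E_n}$ is the characteristic vector of $C$; and $\mathrm{P}_{\mathrm{cycl}}^{\ell}(n)=\operatorname{conv}\{\chi(C): C\in\mathcal{C}^{\ell}(n)\}\subseteq\mathbb{R}^{E_n}$. The symmetric group $\mathfrak{S}(n)$ acts on $E_n$ by $\pi.\{v,w\}=\{\pi(v),\pi(w)\}$ and hence on $\mathbb{R}^{E_n}$ by $(\pi.x)_{\{v,w\}}=x_{\{\pi^{-1}(v),\pi^{-1}(w)\}}$; this action maps $\mathrm{P}_{\mathrm{cycl}}^{\ell}(n)$ to itself. An extension of a polytope $P\subseteq\mathbb{R}^m$ is a polyhedron $Q\subseteq\mathbb{R}^d$ together with an affine map $p:\mathbb{R}^d\to\mathbb{R}^m$ with $p(Q)=P$. An extended formulation for $P$ is a finite system of linear equations and inequalities whose solution set, together with some such map $p$, is an extension of $P$. Its size is its number of inequalities (including nonnegativity constraints, but not equations). Extended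 formulations for a family of polytopes $P\subseteq\mathbb{R}^m$ (varying $m$) are compact if their sizes and the encoding lengths of the coefficients needed to describe them are bounded by a polynomial in $m$ and the maximal encoding length of the components of the vertices of $P$. $\mathfrak{S}(d)$ acts on $\mathbb{R}^d$ by coordinate permutations, $(\sigma.y)_j=y_{\sigma^{-1}(j)}$. Let $G$ be a group of affine transformations $\pi$ of $\mathbb{R}^m$ with $\pi.P=P$. An extended formulation $A^{=}y=b^{=}$, $A^{\le}y\le b^{\le}$ of $P$ with solution set $Q\subseteq\mathbb{R}^d$ and projection $p$ is symmetric with respect to $G$ if for every $\pi\in G$ there are a permutation $\varkappa_\pi\in\mathfrak{S}(d)$ with $p(\varkappa_\pi.y)=\pi.p(y)$ for all $y\in Q$, and permutations $\varrho^{=}_\pi$, $\varrho^{\le}_\pi$ of the rows of $(A^{=},b^{=})$ and $(A^{\le},b^{\le})$, respectively, such that simultaneously permuting the columns of $A^{=}$ (resp. $A^{\le}$) by $\varkappa_\pi$ and the rows of $(A^{=},b^{=})$ by $\varrho^{=}_\pi$ (resp. of $(A^{\le},b^{\le})$ by $\varrho^{\le}_\pi$) leaves $(A^{=},b^{=})$ (resp. $(A^{\le},b^{\le})$) unchanged. *)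

theory Defs
  imports "HOL-Analysis.Analysis" "HOL-Analysis.Finite_Function_Topology"
    "HOL-Combinatorics.Permutations" "HOL-Library.Log_Nat"
begin

section \<open>Coordinate spaces\<close>

text \<open>
  The space of real vectors indexed by a finite set \<open>I\<close> is rendered as the set of finitely
  supported functions with support in \<open>I\<close>. This makes the index set a term rather than a type,
  while \<^typ>\<open>'i \<Rightarrow>\<^sub>0 real\<close> is an instance of \<^class>\<open>real_vector\<close>, so that
  \<^const>\<open>hull\<close>, \<^const>\<open>linear\<close> and \<^const>\<open>extreme_point_of\<close> are applicable.
\<close>

definition coord_space :: "'i set \<Rightarrow> ('i \<Rightarrow>\<^sub>0 real) set" where
  "coord_space I = {x. Poly_Mapping.keys x \<subseteq> I}"

definition affine_map_between ::
    "'j set \<Rightarrow> 'i set \<Rightarrow> (('j \<Rightarrow>\<^sub>0 real) \<Rightarrow> ('i \<Rightarrow>\<^sub>0 real)) \<Rightarrow> bool" where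
  "affine_map_between J I p \<longleftrightarrow>
     p ` coord_space J \<subseteq> coord_space I \<and>
     (\<exists>h t. linear h \<and> (\<forall>y\<in>coord_space J. p y = h y + t))"

text \<open>
  The action \<open>(\<sigma>.y)\<^sub>j = y\<close> at index \<open>\<sigma>\<inverse> j\<close>; note that \<^const>\<open>Poly_Mapping.map_key\<close>
  precomposes with its (injective) first argument.
\<close>

definition permute_coords :: "('j \<Rightarrow> 'j) \<Rightarrow> ('j \<Rightarrow>\<^sub>0 real) \<Rightarrow> ('j \<Rightarrow>\<^sub>0 real)" where
  "permute_coords \<sigma> y = Poly_Mapping.map_key (inv \<sigma>) y"

section \<open>Extended formulations\<close>

text \<open>
  A finite system of \<open>n_eqs\<close> equations and \<open>n_ineqs\<close> inequalities in the variables
  \<open>y\<^sub>0, \<dots>, y\<^sub>d\<^sub>-\<^sub>1\<close> with \<open>d = n_vars\<close>. Matrix entries outside these ranges are irrelevant.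
\<close>

record lin_system =
  n_vars :: nat
  n_eqs :: nat
  A_eq :: "nat \<Rightarrow> nat \<Rightarrow> real"
  b_eq :: "nat \<Rightarrow> real"
  n_ineqs :: nat
  A_le :: "nat \<Rightarrow> nat \<Rightarrow> real"
  b_le :: "nat \<Rightarrow> real"

definition solutions :: "lin_system \<Rightarrow> (nat \<Rightarrow>\<^sub>0 real) set" where
  "solutions F =
     {y \<in> coord_space {..<n_vars F}.
        (\<forall>i<n_eqs F. (\<Sum>j<n_vars F. A_eq F i j * Poly_Mapping.lookup y j) = b_eq F i) \<and>
        (\<forall>i<n_ineqs F. (\<Sum>j<n_vars F. A_le F i j * Poly_Mapping.lookup y j) \<le> b_le F i)}"

definition coefficients :: "lin_system \<Rightarrow> real set" where
  "coefficients F =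
     {A_eq F i j | i j. i < n_eqs F \<and> j < n_vars F} \<union> {b_eq F i | i. i < n_eqs F} \<union>
     {A_le F i j | i j. i < n_ineqs F \<and> j < n_vars F} \<union> {b_le F i | i. i < n_ineqs F}"

definition extended_formulation ::
    "'i set \<Rightarrow> ('i \<Rightarrow>\<^sub>0 real) set \<Rightarrow> lin_system \<Rightarrow> ((nat \<Rightarrow>\<^sub>0 real) \<Rightarrow> ('i \<Rightarrow>\<^sub>0 real)) \<Rightarrow> bool" where
  "extended_formulation I P F p \<longleftrightarrow>
     affine_map_between {..<n_vars F} I p \<and> p ` solutions F = P"

definition symmetric_formulation ::
    "(('i \<Rightarrow>\<^sub>0 real) \<Rightarrow> ('i \<Rightarrow>\<^sub>0 real)) set \<Rightarrow> lin_system \<Rightarrow>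
     ((nat \<Rightarrow>\<^sub>0 real) \<Rightarrow> ('i \<Rightarrow>\<^sub>0 real)) \<Rightarrow> bool" where
  "symmetric_formulation G F p \<longleftrightarrow>
     (\<forall>g\<in>G. \<exists>\<kappa>. \<kappa> permutes {..<n_vars F} \<and>
        (\<forall>y\<in>solutions F. p (permute_coords \<kappa> y) = g (p y)) \<and>
        (\<exists>\<rho>. \<rho> permutes {..<n_eqs F} \<and>
           (\<forall>i<n_eqs F. b_eq F (\<rho> i) = b_eq F i \<and>
              (\<forall>j<n_vars F. A_eq F (\<rho> i) (\<kappa> j) = A_eq F i j))) \<and>
        (\<exists>\<rho>. \<rho> permutes {..<n_ineqs F} \<and>
           (\<forall>i<n_ineqs F. b_le F (\<rho> i) = b_le F i \<and>
              (\<forall>j<n_vars F. A_le F (\<rho> i) (\<kappa> j) = A_le F i j))))"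

section \<open>Compactness\<close>

text \<open>
  The usual binary encoding lengths: \<open>1 + \<lceil>log\<^sub>2 (\<bar>z\<bar> + 1)\<rceil>\<close> for an integer \<open>z\<close>, and the sum of the
  encoding lengths of numerator and denominator, in lowest terms, for a rational number.
\<close>

definition int_enc_length :: "int \<Rightarrow> nat" where
  "int_enc_length z = 1 + nat (bitlen \<bar>z\<bar>)"

definition enc_length :: "rat \<Rightarrow> nat" where
  "enc_length r = (case quotient_of r of (a, b) \<Rightarrow> int_enc_length a + int_enc_length b)"

text \<open>The supremum is a maximum for a rational polytope, and \<open>0\<close> for the empty one.\<close>

definition max_vertex_enc_length :: "'i set \<Rightarrow> ('i \<Rightarrow>\<^sub>0 real) set \<Rightarrow> nat" where
  "max_vertex_enc_length I P =
     Sup {enc_length r | r x i. x extreme_point_of P \<and> i \<in> I \<and> Poly_Mapping.lookup x i = of_rat r}"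

text \<open>
  A family of formulations, indexed by \<open>k \<in> K\<close>, for polytopes \<open>P k\<close> in the space with
  coordinates \<open>I k\<close>. In particular all coefficients have to be rational.
\<close>

definition compact_family ::
    "'k set \<Rightarrow> ('k \<Rightarrow> 'i set) \<Rightarrow> ('k \<Rightarrow> ('i \<Rightarrow>\<^sub>0 real) set) \<Rightarrow> ('k \<Rightarrow> lin_system) \<Rightarrow> bool" where
  "compact_family K I P F \<longleftrightarrow>
     (\<exists>q :: real \<times> real \<Rightarrow> real. real_polynomial_function q \<and>
        (\<forall>k\<in>K.
           (let B = q (real (card (I k)), real (max_vertex_enc_length (I k) (P k)))
            in real (n_ineqs (F k)) \<le> B \<and>
               (\<forall>a\<in>coefficients (F k). \<exists>r. a = of_rat r \<and> real (enc_length r) \<le> B))))"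

section \<open>Cycle polytopes\<close>

definition complete_edges :: "nat \<Rightarrow> nat set set" where
  "complete_edges n = {e. e \<subseteq> {1..n} \<and> card e = 2}"

text \<open>\<open>vs\<close> lists the nodes of the cycle in cyclic order.\<close>

definition cycles :: "nat \<Rightarrow> nat \<Rightarrow> nat set set set" where
  "cycles l n =
     {{{vs ! i, vs ! (Suc i mod l)} | i. i < l} | vs.
        3 \<le> l \<and> length vs = l \<and> distinct vs \<and> set vs \<subseteq> {1..n}}"

definition char_vec :: "'e set \<Rightarrow> ('e \<Rightarrow>\<^sub>0 real)" where
  "char_vec C = (\<Sum>e\<in>C. Poly_Mapping.single e 1)"

definition cycle_polytope :: "nat \<Rightarrow> nat \<Rightarrow> (nat set \<Rightarrow>\<^sub>0 real) set" where
  "cycle_polytope l n = convex hull (char_vec ` cycles l n)"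

definition node_actions :: "nat \<Rightarrow> ((nat set \<Rightarrow>\<^sub>0 real) \<Rightarrow> (nat set \<Rightarrow>\<^sub>0 real)) set" where
  "node_actions n = {permute_coords (image \<pi>) | \<pi>. \<pi> permutes {1..n}}"

end

theory Submission
  imports Defs "HOL-Computational_Algebra.Polynomial"
begin

text \<open>
  Averaging over all triples (node permutation, variable permutation, row permutation) turns a
  symmetric formulation into a lift of the cycles under which the node permutations permute the
  slack functions. If there are at most polynomially many inequalities, the stabiliser of a slack
  function has polynomial index in the symmetric group and therefore contains all even permutations
  of the nodes outside a set of bounded size \<open>k\<close>.

  Now take cycles that run through \<open>2 * m\<close> fixed edges, the tokens, whose inner nodes are joined in
  pairs, the blocks; let a block be split if exactly one of its two tokens belongs to a fixed set of
  an odd number \<open>a\<close> of tokens. That number being odd, so is the number of split blocks; this is the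
  blossom inequality. Permuting tokens is an even permutation of nodes. Hence a slack function sees
  only the positions of at most \<open>k\<close> tokens, and its average over the arrangements with \<open>j\<close> split
  blocks is a polynomial of degree at most \<open>k\<close> in \<open>j\<close>. Extrapolating from \<open>j = 1, 3, \<dots>, 2 * k + 1\<close> to
  \<open>j = 0\<close> keeps these averages nonnegative, so the corresponding affine combination of the lifted
  cycles is feasible, but it projects to a point violating the blossom inequality.
\<close>

text \<open>The obstacle: a cycle obeys a global parity, while a slack function of a small symmetric
  formulation looks at boundedly many tokens. No arrangement has zero split blocks, so only signed
  weights can imitate one, and the difficulty is to keep every slack nonnegative under them. This is
  settled by revealing whole blocks: among the arrangements with j split blocks, the share of those
  with prescribed contents in k blocks is, up to a positive constant, a product of k factors linear
  in j. At j = 0 the factors of unsplit blocks are nonnegative because k is small against the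
  numbers of coloured and uncoloured tokens, and as soon as one prescribed block is split the
  product vanishes. Tokens are edges rather than nodes, so that they can be teeth of the blossom
  inequality and the alternating group suffices for permuting them. The sizes fit because k is fixed
  once the polynomial bound is known: \<open>t choose (k + 1)\<close> with t near n / (k + 3)
  outgrows n ^ (k - 1), while the cycles need just 8 * k + 4 nodes.\<close>

hide_const (open) Finite_Cartesian_Product.transpose

section \<open>Subgroups of small index in a symmetric group\<close>

lemma permutes_map_subset:
  assumes "finite X" "Y \<subseteq> X" "Z \<subseteq> X" "card Y = card Z"
  obtains \<pi> where "\<pi> permutes X" "\<pi> ` Y = Z"
proof -
  have fin: "finite Y" "finite Z"
    using assms finite_subset by auto
  obtain f where f: "bij_betw f Y Z"
    using fin assms(4) finite_same_card_bij by blast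
  have "card (X - Y) = card (X - Z)"
    using assms fin by (simp add: card_Diff_subset)
  then obtain g where g: "bij_betw g (X - Y) (X - Z)"
    using assms(1) finite_same_card_bij by (metis finite_Diff)
  define \<pi> where "\<pi> x = (if x \<in> Y then f x else if x \<in> X then g x else x)" for x
  have 1: "bij_betw \<pi> Y Z"
    using f by (auto simp: \<pi>_def cong: bij_betw_cong)
  have 2: "bij_betw \<pi> (X - Y) (X - Z)"
    using g by (rule iffD1[OF bij_betw_cong, rotated]) (auto simp: \<pi>_def)
  have "bij_betw \<pi> (Y \<union> (X - Y)) (Z \<union> (X - Z))"
    by (rule bij_betw_combine[OF 1 2]) auto
  then have "bij_betw \<pi> X X"
    using assms by (simp add: Un_absorb1)
  then have "\<pi> permutes X"
    by (rule bij_imp_permutes) (use assms in \<open>auto simp: \<pi>_def\<close>)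
  with 1 show ?thesis
    using that by (auto simp: bij_betw_def)
qed

text \<open>The map \<open>\<phi>\<close> replaces the quotient by \<open>U\<close>: permutations
  with equal labels lie in the same right coset, so the number of labels bounds the index. In the
  application \<open>\<phi> \<pi>\<close> is a slack function precomposed with \<pi>.\<close>

locale bounded_index_subgroup =
  fixes V :: "'a set" and U :: "('a \<Rightarrow> 'a) set" and \<phi> :: "('a \<Rightarrow> 'a) \<Rightarrow> 'x" and D :: nat
  assumes finite_V: "finite V"
    and permutes: "u \<in> U \<Longrightarrow> u permutes V"
    and comp_closed: "u \<in> U \<Longrightarrow> v \<in> U \<Longrightarrow> u \<circ> v \<in> U"
    and inv_closed: "u \<in> U \<Longrightarrow> inv u \<in> U"
    and coset: "\<pi> permutes V \<Longrightarrow> \<pi>' permutes V \<Longrightarrow> \<phi> \<pi> = \<phi> \<pi>' \<Longrightarrow> \<pi> \<circ> inv \<pi>' \<in> U"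
    and index_le: "card (\<phi> ` {\<pi>. \<pi> permutes V}) \<le> D"
begin

lemma id_closed: "id \<in> U"
  using coset[of id id] by (simp add: permutes_id)

text \<open>All counting uses the index in this form: permutations that are pairwise incongruent
  modulo \<open>U\<close> carry distinct labels.\<close>

lemma card_le_index:
  assumes "finite A" and perm: "\<And>x. x \<in> A \<Longrightarrow> f x permutes V"
    and "\<And>x y. x \<in> A \<Longrightarrow> y \<in> A \<Longrightarrow> f x \<circ> inv (f y) \<in> U \<Longrightarrow> x = y"
  shows "card A \<le> D"
proof -
  have "inj_on (\<lambda>x. \<phi> (f x)) A"
    using assms coset by (meson inj_onI)
  then have "card A \<le> card (\<phi> ` {\<pi>. \<pi> permutes V})"
    by (rule card_inj_on_le) (use perm finite_permutations[OF finite_V] in auto)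
  with index_le show ?thesis by simp
qed

section \<open>Sets invariant under a pointwise stabiliser\<close>

definition fixing :: "'a set \<Rightarrow> ('a \<Rightarrow> 'a) set" where
  "fixing T = {u \<in> U. \<forall>x\<in>T. u x = x}"

lemma fixing_comp: "u \<in> fixing T \<Longrightarrow> v \<in> fixing T \<Longrightarrow> u \<circ> v \<in> fixing T"
  by (auto simp: fixing_def comp_closed)

text \<open>Every set of size \<open>card Y\<close> in \<open>V - T\<close> is carried to
  \<open>Y\<close> by some permutation supported off \<open>T\<close>. If the carriers of two such
  sets are congruent, their quotient lies in \<open>U\<close> and fixes \<open>T\<close>, hence
  preserves \<open>Y\<close>, and the two sets coincide.\<close>

lemma choose_invariant_le:
  assumes "T \<subseteq> V" "Y \<subseteq> V - T" and inv: "\<And>u. u \<in> fixing T \<Longrightarrow> u ` Y \<subseteq> Y"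
  shows "card (V - T) choose card Y \<le> D"
proof -
  let ?A = "{Z. Z \<subseteq> V - T \<and> card Z = card Y}"
  have finX: "finite (V - T)" using finite_V by simp
  have "\<exists>\<pi>. \<pi> permutes (V - T) \<and> \<pi> ` Z = Y" if "Z \<in> ?A" for Z
    using permutes_map_subset[OF finX, of Z Y] that assms(2) by blast
  then obtain f where f: "\<And>Z. Z \<in> ?A \<Longrightarrow> f Z permutes (V - T) \<and> f Z ` Z = Y"
    by metis
  have "card ?A \<le> D"
  proof (rule card_le_index[where f = f])
    show "finite ?A" using finX by simp
    show "f Z permutes V" if "Z \<in> ?A" for Z
      using f[OF that] permutes_subset by blast
    fix Z Z' assume Z: "Z \<in> ?A" "Z' \<in> ?A" and u: "f Z \<circ> inv (f Z') \<in> U"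
    have "f Z \<circ> inv (f Z') \<in> fixing T"
      using u f[OF Z(1)] permutes_inv[OF conjunct1[OF f[OF Z(2)]]]
      by (auto simp: fixing_def permutes_def)
    then have "(f Z \<circ> inv (f Z')) ` Y \<subseteq> Y" by (rule inv)
    moreover have "inv (f Z') ` Y = Z'"
      using f[OF Z(2)] by (metis inv_o_cancel image_comp image_id permutes_inj id_apply)
    ultimately have "f Z ` Z' \<subseteq> f Z ` Z"
      using f[OF Z(1)] by (metis image_comp)
    then have "Z' \<subseteq> Z"
      using f[OF Z(1)] permutes_inj by (metis inj_image_subset_iff)
    then show "Z = Z'"
      using Z finX card_subset_eq[of Z Z'] finite_subset[of Z "V - T"] by auto
  qed
  then show ?thesis
    using n_subsets[OF finX] by simp
qed

text \<open>If the identity were the only element of \<open>U\<close> supported in \<open>S\<close>,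
  all \<open>fact (card S)\<close> permutations of \<open>S\<close> would be pairwise
  incongruent.\<close>

lemma ex_nontrivial:
  assumes "S \<subseteq> V" "D < fact (card S)"
  obtains g where "g \<in> U" "g permutes S" "g \<noteq> id"
proof (rule ccontr)
  assume "\<not> thesis"
  with that have *: "g = id" if "g \<in> U" "g permutes S" for g
    using that by blast
  have finS: "finite S" using assms finite_V finite_subset by blast
  have "card {\<pi>. \<pi> permutes S} \<le> D"
  proof (rule card_le_index[where f = "\<lambda>x. x"])
    show "finite {\<pi>. \<pi> permutes S}" using finite_permutations[OF finS] .
    show "x permutes V" if "x \<in> {\<pi>. \<pi> permutes S}" for x
      using that assms permutes_subset by blast
    fix x y assume xy: "x \<in> {\<pi>. \<pi> permutes S}" "y \<in> {\<pi>. \<pi> permutes S}" "x \<circ> inv y \<in> U"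
    then have "x \<circ> inv y = id"
      using * permutes_compose permutes_inv by (metis mem_Collect_eq)
    then have "x \<circ> inv y \<circ> y = y" by simp
    then show "x = y"
      using xy(2) by (simp add: comp_assoc permutes_inv_o)
  qed
  then show False
    using assms(2) card_permutations[OF refl finS] by simp
qed

text \<open>Conjugating \<open>g\<close> by \<open>h\<close> merely replaces \<open>x\<close> by
  \<open>h x\<close>, since \<open>h\<close> fixes the rest of \<open>S\<close>, which contains the
  support of \<open>g\<close>, and sends \<open>x\<close> outside \<open>S\<close>. Composing
  \<open>inv g\<close> with this conjugate cancels everything but a three-cycle on
  \<open>h x\<close>, \<open>x\<close> and \<open>inv g x\<close>.\<close>

lemma three_cycle:
  assumes "g \<in> U" "g permutes S" "x \<in> S" "g x \<noteq> x" "h \<in> fixing (S - {x})" "h x \<noteq> x"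
  shows "transpose (h x) x \<circ> transpose x (inv g x) \<in> U"
proof -
  have hU: "h \<in> U" and hfix: "\<And>y. y \<in> S \<Longrightarrow> y \<noteq> x \<Longrightarrow> h y = y"
    using assms by (auto simp: fixing_def)
  have hp: "h permutes V" using hU permutes by blast
  have gi: "inv g permutes S" using assms permutes_inv by blast
  have hx: "h x \<notin> S"
    using hfix permutes_inj[OF hp] assms(3,6) by (metis injD)
  let ?z = "inv g x"
  have z: "?z \<in> S" "?z \<noteq> x" "g ?z = x"
    using assms permutes_in_image[OF gi] by (auto simp: permutes_inverses permutes_inv_eq)
  have gx: "g x \<in> S" using assms permutes_in_image by metis
  have inj: "inj g" "inj h" using assms hp permutes_inj by auto
  have "inv g \<circ> h \<circ> g \<circ> inv h = transpose (h x) x \<circ> transpose x ?z"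
  proof (rule ext)
    fix y
    obtain w where y: "y = h w" using permutes_surj[OF hp] by (meson surjD)
    have ih: "inv h y = w" using y inj by simp
    have ig: "inv g (g v) = v" for v using inj by simp
    have nS: "g v = v" "inv g v = v" if "v \<notin> S" for v
      using that assms gi by (auto simp: permutes_def)
    show "(inv g \<circ> h \<circ> g \<circ> inv h) y = (transpose (h x) x \<circ> transpose x ?z) y"
    proof (cases "w \<in> S")
      case True
      consider "w = x" | "w = ?z" | "w \<noteq> x" "w \<noteq> ?z" by blast
      then show ?thesis
      proof cases
        case 1
        then have "y = h x" using y by simp
        moreover have "h (g x) = g x" using hfix gx assms(4) by simp
        moreover have "h x \<noteq> ?z" using hx z by metis
        ultimately show ?thesis using ih 1 ig assms(6)
          by (simp add: Transposition.transpose_def)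
      next
        case 2
        then have "y = ?z" using y hfix z by simp
        moreover have "g w = x" using 2 z by simp
        ultimately show ?thesis using ih nS[OF hx] z hx
          by (auto simp: Transposition.transpose_def)
      next
        case 3
        then have "y = w" using y hfix True by simp
        moreover have "g w \<noteq> x" using 3 z ig by metis
        moreover have "g w \<in> S" using True assms permutes_in_image by metis
        ultimately show ?thesis using ih ig hfix 3 True hx
          by (auto simp: Transposition.transpose_def)
      qed
    next
      case False
      then have gw: "g w = w" using nS by simp
      have "w = y" if "y \<in> S - {x}"
        using that hfix y inj(2) by (metis DiffE injD singletonI)
      with False have yS: "y \<in> S \<Longrightarrow> y = x" by auto
      have "y \<noteq> h x" using y False assms(3) inj(2) by (metis injD)
      show ?thesis
      proof (cases "y = x")
        case True
        moreover have "h x \<noteq> ?z" using hx z by metis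
        ultimately show ?thesis using ih gw y z assms(6) by (simp add: Transposition.transpose_def)
      next
        case yx: False
        then have "y \<notin> S" using yS by auto
        then show ?thesis using ih gw y nS z \<open>y \<noteq> h x\<close> yx
          by (auto simp: Transposition.transpose_def)
      qed
    qed
  qed
  moreover have "inv g \<circ> h \<circ> g \<circ> inv h \<in> U"
    using assms(1) hU comp_closed inv_closed by simp
  ultimately show ?thesis by simp
qed

text \<open>Such products of two transpositions are the three-cycles, and these generate the
  alternating group on \<open>Y\<close>. The condition thus says that \<open>U\<close> contains that
  group, without mentioning signs of permutations.\<close>

definition all_three_cycles :: "'a set \<Rightarrow> bool" where
  "all_three_cycles Y \<longleftrightarrow>
     (\<forall>x\<in>Y. \<forall>y\<in>Y. \<forall>z\<in>Y. x \<noteq> y \<longrightarrow> y \<noteq> z \<longrightarrow> x \<noteq> z \<longrightarrow> transpose x y \<circ> transpose y z \<in> U)"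

lemma transpose_cancel: "f \<circ> transpose a b \<circ> (transpose a b \<circ> g) = f \<circ> g"
  by (simp add: fun_eq_iff)

text \<open>Products of two transpositions through a common centre generate all even permutations;
  each case writes one three-cycle in this way. The star form is preferred because it telescopes: a
  pair \<open>i\<close>, \<open>j\<close> can be split at any intermediate point.\<close>

lemma all_three_cycles_star:
  assumes x: "x \<in> Y"
    and star: "\<And>i j. i \<in> Y - {x} \<Longrightarrow> j \<in> Y - {x} \<Longrightarrow> transpose i x \<circ> transpose j x \<in> U"
  shows "all_three_cycles Y"
  unfolding all_three_cycles_def
proof (intro ballI impI)
  fix a b c assume abc: "a \<in> Y" "b \<in> Y" "c \<in> Y" "a \<noteq> b" "b \<noteq> c" "a \<noteq> c"
  consider "a = x" | "b = x" | "c = x" | "a \<noteq> x" "b \<noteq> x" "c \<noteq> x" by blast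
  then show "transpose a b \<circ> transpose b c \<in> U"
  proof cases
    case 1
    then have "transpose a b \<circ> transpose b c = transpose c x \<circ> transpose b x"
      using abc by (auto simp: fun_eq_iff Transposition.transpose_def)
    then show ?thesis using star[of c b] abc 1 by auto
  next
    case 2
    then show ?thesis using star[of a c] abc by (auto simp: transpose_commute)
  next
    case 3
    then have "transpose a b \<circ> transpose b c = (transpose a x \<circ> transpose b x) \<circ> (transpose a x \<circ> transpose b x) \<circ> (transpose b x \<circ> transpose b x)"
      using abc by (auto simp: fun_eq_iff Transposition.transpose_def)
    then show ?thesis using star[of a b] abc 3 comp_closed by auto
  next
    case 4
    then have "transpose a b \<circ> transpose b c =
        (transpose a x \<circ> transpose b x) \<circ> (transpose a x \<circ> transpose b x) \<circ> (transpose c x \<circ> transpose b x)"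
      using abc by (auto simp: fun_eq_iff Transposition.transpose_def)
    then show ?thesis using star[of a b] star[of c b] abc 4 comp_closed by auto
  qed
qed

lemma all_three_cycles_starD:
  assumes "all_three_cycles Y" "x \<in> Y" "i \<in> Y - {x}" "j \<in> Y - {x}"
  shows "transpose i x \<circ> transpose j x \<in> U"
proof (cases "i = j")
  case True
  then show ?thesis using id_closed by (simp add: id_def[symmetric])
next
  case False
  then show ?thesis using assms by (auto simp: all_three_cycles_def transpose_commute[of j x])
qed

text \<open>Two common points are used: \<open>x\<close> is the centre of the star and
  \<open>w\<close> the intermediate point. Even if \<open>i\<close> and \<open>j\<close> lie in
  different sets, the pairs \<open>i\<close>, \<open>w\<close> and \<open>w\<close>,
  \<open>j\<close> each lie in one of them together with \<open>x\<close>.\<close>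

lemma all_three_cycles_Un:
  assumes "all_three_cycles Y" "all_three_cycles Z" "x \<in> Y \<inter> Z" "w \<in> Y \<inter> Z" "x \<noteq> w"
  shows "all_three_cycles (Y \<union> Z)"
proof (rule all_three_cycles_star)
  show "x \<in> Y \<union> Z" using assms by auto
  have step: "transpose i x \<circ> transpose w x \<in> U \<and> transpose w x \<circ> transpose i x \<in> U"
    if "i \<in> Y \<union> Z - {x}" for i
    using that assms all_three_cycles_starD[of Y x i w] all_three_cycles_starD[of Z x i w]
      all_three_cycles_starD[of Y x w i] all_three_cycles_starD[of Z x w i] by blast
  fix i j assume ij: "i \<in> Y \<union> Z - {x}" "j \<in> Y \<union> Z - {x}"
  have "(transpose i x \<circ> transpose w x) \<circ> (transpose w x \<circ> transpose j x) \<in> U"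
    using step[OF ij(1)] step[OF ij(2)] comp_closed by blast
  then show "transpose i x \<circ> transpose j x \<in> U"
    by (simp only: transpose_cancel)
qed

lemma all_three_cycles_image:
  assumes "all_three_cycles Y" "u \<in> U"
  shows "all_three_cycles (u ` Y)"
  unfolding all_three_cycles_def
proof (intro ballI impI, elim imageE, hypsubst)
  fix x y z assume h: "u x \<noteq> u y" "u y \<noteq> u z" "u x \<noteq> u z" "x \<in> Y" "y \<in> Y" "z \<in> Y"
  have inj: "inj u" and surj: "surj u"
    using assms permutes permutes_inj permutes_surj by blast+
  have tr: "transpose (u a) (u b) (u c) = u (transpose a b c)" for a b c
    using inj by (auto simp: Transposition.transpose_def dest: injD)
  have "transpose (u x) (u y) \<circ> transpose (u y) (u z) = u \<circ> (transpose x y \<circ> transpose y z) \<circ> inv u"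
  proof
    fix v obtain w where "v = u w" using surj by (meson surjD)
    then show "(transpose (u x) (u y) \<circ> transpose (u y) (u z)) v = (u \<circ> (transpose x y \<circ> transpose y z) \<circ> inv u) v"
      using inj by (simp add: tr)
  qed
  moreover have "transpose x y \<circ> transpose y z \<in> U"
    using h assms(1) unfolding all_three_cycles_def by metis
  ultimately show "transpose (u x) (u y) \<circ> transpose (u y) (u z) \<in> U"
    using assms(2) comp_closed inv_closed by simp
qed

end

text \<open>The size \<open>t\<close> is auxiliary. The bound on \<open>D\<close> excludes invariant
  sets of intermediate size; \<open>t * (k + 3)\<close> points make room for the counting argument
  and force large subsets to overlap; \<open>3 * k + 3 \<le> t\<close> ensures that two sets of size
  at most \<open>k\<close> never cover almost everything.\<close>

locale small_index_subgroup = bounded_index_subgroup +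
  fixes k t :: nat
  assumes D_less: "D < t choose (k + 1)"
    and t_small: "t * (k + 3) \<le> card V"
    and t_pos: "3 * k + 3 \<le> t"
begin

text \<open>Binomial coefficients grow towards the middle, so an invariant set whose size misses
  both alternatives would have at least \<open>t choose (k + 1)\<close> translates, more than the
  index permits.\<close>

lemma invariant_card:
  assumes "T \<subseteq> V" "card T \<le> t" "Y \<subseteq> V - T" "\<And>u. u \<in> fixing T \<Longrightarrow> u ` Y \<subseteq> Y"
  shows "card Y \<le> k \<or> card (V - T) \<le> card Y + k"
proof (rule ccontr)
  assume neg: "\<not> ?thesis"
  let ?x = "card (V - T)" and ?y = "card Y"
  have "?x = card V - card T"
    using assms(1) finite_V by (simp add: card_Diff_subset finite_subset)
  then have tx: "t \<le> ?x" using t_small assms(2) by (simp add: algebra_simps)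
  have "t choose (k + 1) \<le> ?x choose (k + 1)"
    using tx by (rule binomial_right_mono)
  also have "\<dots> \<le> ?x choose ?y"
  proof (cases "2 * ?y \<le> ?x")
    case True
    then show ?thesis using neg by (intro binomial_mono) auto
  next
    case False
    have "?x choose (k + 1) \<le> ?x choose (?x - ?y)"
      using neg False by (intro binomial_mono) auto
    also have "\<dots> = ?x choose ?y"
      using neg binomial_symmetric[of ?y ?x] by simp
    finally show ?thesis .
  qed
  also have "\<dots> \<le> D" using assms choose_invariant_le by blast
  finally show False using D_less by simp
qed

section \<open>Points with small orbits\<close>

definition orb :: "'a set \<Rightarrow> 'a \<Rightarrow> 'a set" where
  "orb T x = (\<lambda>u. u x) ` fixing T"

lemma orb_self: "x \<in> orb T x"
  using id_closed by (auto simp: orb_def fixing_def intro!: image_eqI[where x = id])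

lemma orb_invariant: "u \<in> fixing T \<Longrightarrow> u ` orb T x \<subseteq> orb T x"
  by (auto simp: orb_def intro!: image_eqI[where x = "u \<circ> _"] fixing_comp)

lemma orb_subset:
  assumes "T \<subseteq> V" "x \<in> V - T"
  shows "orb T x \<subseteq> V - T"
proof
  fix y assume "y \<in> orb T x"
  then obtain u where u: "u \<in> fixing T" "y = u x" by (auto simp: orb_def)
  then have up: "u permutes V" using permutes by (auto simp: fixing_def)
  have "u x \<notin> T"
    using u assms permutes_inj[OF up] by (auto simp: fixing_def dest: injD)
  moreover have "u x \<in> V" using up assms permutes_in_image by fastforce
  ultimately show "y \<in> V - T" using u by simp
qed

definition bad :: "'a set \<Rightarrow> 'a set" where
  "bad T = {x \<in> V - T. card (orb T x) \<le> k}"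

text \<open>A largest invariant set \<open>Z\<close> of size at most \<open>k\<close> absorbs every
  small orbit: the union has at most \<open>2 * k\<close> points, too few for the second alternative
  of \<open>invariant_card\<close>, so it has at most \<open>k\<close> points and maximality
  applies.\<close>

lemma card_bad:
  assumes "T \<subseteq> V" "card T \<le> t"
  shows "card (bad T) \<le> k"
proof -
  let ?P = "\<lambda>Z. Z \<subseteq> V - T \<and> card Z \<le> k \<and> (\<forall>u\<in>fixing T. u ` Z \<subseteq> Z)"
  have "?P {}" by auto
  moreover have "\<forall>Z. ?P Z \<longrightarrow> card Z < Suc k" by simp
  ultimately have "\<exists>Z. ?P Z \<and> (\<forall>Z'. ?P Z' \<longrightarrow> card Z' \<le> card Z)"
    by (rule ex_has_greatest_nat)
  then obtain Z where Zmax: "?P Z \<and> (\<forall>Z'. ?P Z' \<longrightarrow> card Z' \<le> card Z)" ..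
  then have Z: "?P Z" ..
  have max: "card Z' \<le> card Z" if "?P Z'" for Z' using Zmax that by blast
  have finZ: "finite Z" using Z finite_V finite_subset by blast
  have "card (V - T) = card V - card T"
    using assms(1) finite_V by (simp add: card_Diff_subset finite_subset)
  then have X: "3 * k + 3 \<le> card (V - T)" using t_small t_pos assms(2) by (simp add: algebra_simps)
  have "bad T \<subseteq> Z"
  proof
    fix x assume x: "x \<in> bad T"
    let ?O = "orb T x"
    have OX: "?O \<subseteq> V - T" and Ok: "card ?O \<le> k"
      using x orb_subset[OF assms(1)] by (auto simp: bad_def)
    have inv: "u ` (Z \<union> ?O) \<subseteq> Z \<union> ?O" if "u \<in> fixing T" for u
      using Z orb_invariant[OF that, of x] that by blast
    have le: "card (Z \<union> ?O) \<le> 2 * k" using card_Un_le[of Z ?O] Z Ok by simp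
    have "card (Z \<union> ?O) \<le> k \<or> card (V - T) \<le> card (Z \<union> ?O) + k"
      using Z OX inv by (intro invariant_card assms) auto
    then have "card (Z \<union> ?O) \<le> k" using X le by linarith
    then have "card (Z \<union> ?O) \<le> card Z"
      using max[of "Z \<union> ?O"] Z OX inv by blast
    moreover have "finite (Z \<union> ?O)" using finZ OX finite_V finite_subset by blast
    ultimately have "Z \<union> ?O = Z" using card_seteq[of "Z \<union> ?O" Z] by auto
    then show "x \<in> Z" using orb_self by blast
  qed
  with finZ have "card (bad T) \<le> card Z" by (rule card_mono)
  also have "\<dots> \<le> k" using Z by blast
  finally show ?thesis .
qed

text \<open>Counting the pairs \<open>(S, x)\<close> with \<open>x \<in> bad (S - {x})\<close> shows that some set has no bad point.\<close>

lemma ex_good_set: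
  obtains S where "S \<subseteq> V" "card S = t" "\<And>x. x \<in> S \<Longrightarrow> x \<notin> bad (S - {x})"
proof (rule ccontr)
  assume "\<not> thesis"
  with that have neg: "\<exists>x\<in>S. x \<in> bad (S - {x})" if "S \<subseteq> V" "card S = t" for S
    using that by blast
  let ?A = "{S. S \<subseteq> V \<and> card S = t}" and ?B = "{T. T \<subseteq> V \<and> card T = t - 1}"
  obtain f where f: "\<And>S. S \<in> ?A \<Longrightarrow> f S \<in> S \<and> f S \<in> bad (S - {f S})"
    using neg by (metis (mono_tags, lifting) mem_Collect_eq)
  have finB: "finite ?B" using finite_V by simp
  have finbad: "finite (bad T)" for T using finite_V by (auto simp: bad_def)
  have "inj_on (\<lambda>S. (S - {f S}, f S)) ?A"
  proof (rule inj_onI)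
    fix S S' assume "S \<in> ?A" "S' \<in> ?A" "(S - {f S}, f S) = (S' - {f S'}, f S')"
    then show "S = S'" using f by (metis insert_Diff prod.inject)
  qed
  then have "card ?A \<le> card (Sigma ?B bad)"
  proof (rule card_inj_on_le)
    show "finite (Sigma ?B bad)" using finB finbad by simp
    show "(\<lambda>S. (S - {f S}, f S)) ` ?A \<subseteq> Sigma ?B bad"
    proof
      fix y assume "y \<in> (\<lambda>S. (S - {f S}, f S)) ` ?A"
      then obtain S where S: "S \<in> ?A" "y = (S - {f S}, f S)" by blast
      have "finite S" using S finite_V finite_subset by blast
      then show "y \<in> Sigma ?B bad" using S f[OF S(1)] by auto
    qed
  qed
  also have "\<dots> = (\<Sum>T\<in>?B. card (bad T))"
    using finB finbad by (simp add: card_SigmaI)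
  also have "\<dots> \<le> (\<Sum>T\<in>?B. k)"
    by (intro sum_mono card_bad) auto
  finally have "card V choose t \<le> k * (card V choose (t - 1))"
    using n_subsets[OF finite_V] by (simp add: mult.commute)
  \<comment> \<open>After this scaling both sides are multiples of
    \<open>card V choose (t - 1)\<close>, and it remains to compare the factors \<open>t * k\<close>
    and \<open>card V - (t - 1)\<close>.\<close>
  then have "t * (card V choose t) \<le> t * k * (card V choose (t - 1))"
    by (metis mult.assoc mult_le_mono2)
  moreover have "t * (card V choose t) = (card V - (t - 1)) * (card V choose (t - 1))"
    using t_pos binomial_absorption[of "t - 1" "card V"] binomial_absorb_comp[of "card V" "t - 1"] by simp
  moreover have "t * k < card V - (t - 1)"
    using t_small t_pos by (simp add: algebra_simps)
  moreover have "0 < card V choose (t - 1)"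
    using t_small t_pos by (simp add: algebra_simps)
  ultimately show False
    by (metis mult_less_cancel2 not_le)
qed

text \<open>A good set \<open>S\<close> serves twice: it is large enough to support a nontrivial
  \<open>g\<close> in \<open>U\<close>, and the stabiliser of \<open>S\<close> minus a moved point
  \<open>x\<close> still carries \<open>x\<close> to almost every other point. By
  \<open>three_cycle\<close> each of these images lies on a three-cycle in \<open>U\<close> through
  \<open>x\<close> and \<open>inv g x\<close>.\<close>

lemma ex_large_three_cycles:
  obtains Y where "Y \<subseteq> V" "all_three_cycles Y" "card V \<le> card Y + t + k"
proof -
  obtain S where S: "S \<subseteq> V" "card S = t" "\<And>x. x \<in> S \<Longrightarrow> x \<notin> bad (S - {x})"
    using ex_good_set by blast
  have finS: "finite S" using S finite_V finite_subset by blast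
  have "t choose (k + 1) \<le> fact t"
  proof -
    have "fact (k + 1) * fact (t - (k + 1)) * (t choose (k + 1)) = (fact t :: nat)"
      using t_pos by (intro binomial_fact_lemma) simp
    then show ?thesis
      by (metis One_nat_def Suc_leI fact_gt_zero le_refl mult_1 mult_le_mono nat_0_less_mult_iff)
  qed
  then obtain g where g: "g \<in> U" "g permutes S" "g \<noteq> id"
    using ex_nontrivial[OF S(1)] S(2) D_less by (metis dual_order.strict_trans1 order_less_imp_le)
  then obtain x where x: "g x \<noteq> x" by (metis eq_id_iff)
  then have xS: "x \<in> S" using g by (auto simp: permutes_def)
  define T where "T = S - {x}"
  have T: "T \<subseteq> V" "card T \<le> t" "x \<in> V - T"
    using S xS finS by (auto simp: T_def card_Diff_subset)
  let ?O = "orb T x"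
  have "\<not> card ?O \<le> k" using S(3)[OF xS] T by (auto simp: bad_def T_def)
  then have big: "card (V - T) \<le> card ?O + k"
    using invariant_card[OF T(1,2) orb_subset[OF T(1,3)] orb_invariant] by blast
  let ?z = "inv g x"
  have z: "?z \<noteq> x" "?z \<in> S"
    using x xS g permutes_in_image[OF permutes_inv[OF g(2)]]
    by (auto simp: permutes_inv_eq)
  have c: "transpose i x \<circ> transpose x ?z \<in> U" if i: "i \<in> ?O - {x}" for i
  proof -
    obtain h where "h \<in> fixing T" "i = h x" using i by (auto simp: orb_def)
    then show ?thesis using three_cycle[OF g(1,2) xS x, of h] i by (auto simp: T_def)
  qed
  \<comment> \<open>The point \<open>?z\<close> lies in \<open>T\<close>, hence outside the orbit;
    it joins the set as the second point shared by all the three-cycles found, through which the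
    star at \<open>x\<close> telescopes.\<close>
  let ?Y = "insert ?z ?O"
  have "all_three_cycles ?Y"
  proof (rule all_three_cycles_star)
    show "x \<in> ?Y" using orb_self by simp
    fix i j assume ij: "i \<in> ?Y - {x}" "j \<in> ?Y - {x}"
    have *: "transpose i x \<circ> transpose ?z x \<in> U" if i: "i \<in> ?Y - {x}" for i
    proof (cases "i = ?z")
      case True
      then show ?thesis using id_closed by (simp add: id_def[symmetric])
    next
      case False
      then show ?thesis using c[of i] i by (simp add: transpose_commute)
    qed
    have "transpose ?z x \<circ> transpose j x = inv (transpose j x \<circ> transpose ?z x)"
      by (simp add: o_inv_distrib)
    then have "transpose ?z x \<circ> transpose j x \<in> U"
      using inv_closed[OF *[OF ij(2)]] by simp
    then have "(transpose i x \<circ> transpose ?z x) \<circ> (transpose ?z x \<circ> transpose j x) \<in> U"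
      using *[OF ij(1)] comp_closed by blast
    then show "transpose i x \<circ> transpose j x \<in> U"
      by (simp only: transpose_cancel)
  qed
  moreover have YV: "?Y \<subseteq> V" using orb_subset[OF T(1,3)] z S by auto
  moreover have "card V \<le> card ?Y + t + k"
  proof -
    have "card (V - T) = card V - card T"
      using T finite_V by (simp add: card_Diff_subset finite_subset)
    moreover have "card ?O \<le> card ?Y"
      using YV finite_V by (intro card_mono) (auto intro: finite_subset)
    ultimately show ?thesis using big T(2) by linarith
  qed
  ultimately show ?thesis using that by blast
qed

theorem contains_three_cycles:
  obtains W where "W \<subseteq> V" "card W \<le> k" "all_three_cycles (V - W)"
proof -
  let ?P = "\<lambda>Y. Y \<subseteq> V \<and> all_three_cycles Y"
  obtain Y0 where Y0: "?P Y0" "card V \<le> card Y0 + t + k"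
    using ex_large_three_cycles by blast
  have "\<forall>Y. ?P Y \<longrightarrow> card Y < Suc (card V)" using finite_V by (simp add: card_mono less_Suc_eq_le)
  with Y0(1) have "\<exists>Y. ?P Y \<and> (\<forall>Y'. ?P Y' \<longrightarrow> card Y' \<le> card Y)"
    by (rule ex_has_greatest_nat)
  then obtain Y where Ymax: "?P Y \<and> (\<forall>Y'. ?P Y' \<longrightarrow> card Y' \<le> card Y)" ..
  then have Y: "?P Y" ..
  have max: "card Y' \<le> card Y" if "?P Y'" for Y' using Ymax that by blast
  have finY: "finite Y" using Y finite_V finite_subset by blast
  have big: "card V \<le> card Y + t + k" using max[of Y0] Y0 by linarith
  have n: "3 * t + t * k \<le> card V" using t_small by (simp add: algebra_simps)
  have "u ` Y \<subseteq> Y" if u: "u \<in> U" for u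
  proof -
    have uV: "u ` Y \<subseteq> V" using permutes[OF u] Y permutes_in_image by fastforce
    have cu: "card (u ` Y) = card Y"
      using permutes_inj_on[OF permutes[OF u]] by (rule card_image)
    have "card (Y \<union> u ` Y) + card (Y \<inter> u ` Y) = card Y + card (u ` Y)"
      using finY card_Un_Int[of Y "u ` Y"] by simp
    moreover have "card (Y \<union> u ` Y) \<le> card V"
      using Y uV finite_V by (intro card_mono) auto
    ultimately have "2 * card Y \<le> card V + card (Y \<inter> u ` Y)" using cu by linarith
    moreover have "card V + 2 \<le> 2 * card Y" using big n t_pos by linarith
    ultimately have "2 \<le> card (Y \<inter> u ` Y)" by linarith
    then obtain x w where xw: "x \<in> Y \<inter> u ` Y" "w \<in> Y \<inter> u ` Y" "x \<noteq> w"
      by (metis card_le_Suc_iff numeral_2_eq_2 insertCI)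
    have "all_three_cycles (Y \<union> u ` Y)"
      using all_three_cycles_Un[OF _ all_three_cycles_image[OF _ u] xw] Y by blast
    then have "card (Y \<union> u ` Y) \<le> card Y" using max[of "Y \<union> u ` Y"] Y uV by blast
    then have "Y \<union> u ` Y = Y" using finY card_seteq[of "Y \<union> u ` Y" Y] by auto
    then show ?thesis by blast
  qed
  then have "card Y \<le> k \<or> card (V - {}) \<le> card Y + k"
    using Y by (intro invariant_card) (auto simp: fixing_def)
  then have "card V \<le> card Y + k" using big n t_pos by auto
  then have "card (V - Y) \<le> k" using Y finY by (simp add: card_Diff_subset)
  moreover have "V - (V - Y) = Y" using Y by blast
  ultimately show ?thesis using that[of "V - Y"] Y by auto
qed

end

section \<open>A signed distribution without split blocks\<close>

text \<open>Lagrange interpolation: the weight of a node is the value at \<open>x0\<close> of its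
  basis polynomial. These weights may be negative, which is why the distribution built from them is
  signed.\<close>

lemma exists_extrapolation:
  fixes J :: "real set" and x0 :: real
  assumes "finite J" "card J = Suc k"
  obtains c where "\<And>f :: real poly. degree f \<le> k \<Longrightarrow> (\<Sum>x\<in>J. c x * poly f x) = poly f x0"
proof -
  define L where "L x = (\<Prod>y\<in>J - {x}. smult (1 / (x - y)) [:- y, 1:])" for x
  have deg: "degree (L x) \<le> k" if "x \<in> J" for x
  proof -
    have "degree (L x) \<le> (\<Sum>y\<in>J - {x}. 1)"
      unfolding L_def using assms(1)
      by (intro order.trans[OF degree_prod_sum_le] sum_mono) auto
    then show ?thesis using that assms by simp
  qed
  have val: "poly (L x) y = (if x = y then 1 else 0)" if "x \<in> J" "y \<in> J" for x y
    using that assms(1) by (auto simp: L_def poly_prod prod_zero_iff diff_divide_distrib[symmetric] intro!: prod.neutral)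
  have "(\<Sum>x\<in>J. poly (L x) x0 * poly f x) = poly f x0" if "degree f \<le> k" for f :: "real poly"
  proof -
    have "f = (\<Sum>x\<in>J. smult (poly f x) (L x))"
    proof (rule poly_eqI_degree[where A = J])
      fix y assume y: "y \<in> J"
      have "poly (\<Sum>x\<in>J. smult (poly f x) (L x)) y = (\<Sum>x\<in>J. if x = y then poly f x else 0)"
        unfolding poly_sum poly_smult by (intro sum.cong) (auto simp: val y)
      then show "poly f y = poly (\<Sum>x\<in>J. smult (poly f x) (L x)) y"
        using assms(1) y by simp
    next
      show "degree f < card J" using that assms by simp
      have "degree (\<Sum>x\<in>J. smult (poly f x) (L x)) \<le> k"
        using assms(1) deg by (intro degree_sum_le) (auto intro: order.trans[OF degree_smult_le])
      then show "degree (\<Sum>x\<in>J. smult (poly f x) (L x)) < card J" using assms by simp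
    qed
    then have "poly f x0 = (\<Sum>x\<in>J. poly f x * poly (L x) x0)"
      by (metis (no_types, lifting) poly_smult poly_sum sum.cong)
    then show ?thesis by (simp add: mult.commute)
  qed
  then show ?thesis using that[of "\<lambda>x. poly (L x) x0"] by blast
qed

section \<open>Counting arrangements of coloured items in blocks\<close>

lemma card_swap_count:
  assumes "finite A" "finite B"
  shows "(\<Sum>x\<in>A. card {y \<in> B. R x y}) = (\<Sum>y\<in>B. card {x \<in> A. R x y})"
proof -
  have "(\<Sum>x\<in>A. card {y \<in> B. R x y}) = (\<Sum>x\<in>A. \<Sum>y\<in>B. if R x y then 1 else 0)"
    using assms by (simp add: sum.If_cases Int_def)
  also have "\<dots> = (\<Sum>y\<in>B. \<Sum>x\<in>A. if R x y then 1 else 0)" by (rule sum.swap)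
  also have "\<dots> = (\<Sum>y\<in>B. card {x \<in> A. R x y})"
    using assms by (simp add: sum.If_cases Int_def)
  finally show ?thesis .
qed

locale blocks =
  fixes m a :: nat
  assumes a_le: "a \<le> 2 * m"
begin

text \<open>
  A permutation \<open>\<sigma>\<close> of \<open>{..<2 * m}\<close> places the item \<open>\<sigma> h\<close> in slot \<open>h\<close>; the slots \<open>2 * t\<close> and
  \<open>2 * t + 1\<close> form block \<open>t\<close>, and the items below \<open>a\<close> are coloured.
\<close>

definition block_type :: "(nat \<Rightarrow> nat) \<Rightarrow> nat \<Rightarrow> nat" where
  "block_type \<sigma> t = of_bool (\<sigma> (2 * t) < a) + of_bool (\<sigma> (2 * t + 1) < a)"

definition count_type :: "nat \<Rightarrow> (nat \<Rightarrow> nat) \<Rightarrow> nat" where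
  "count_type \<alpha> \<sigma> = card {t. t < m \<and> block_type \<sigma> t = \<alpha>}"

abbreviation splits :: "(nat \<Rightarrow> nat) \<Rightarrow> nat" where
  "splits \<equiv> count_type 1"

definition agreeing :: "nat \<Rightarrow> (nat \<Rightarrow> nat) \<Rightarrow> nat set \<Rightarrow> (nat \<Rightarrow> nat) set" where
  "agreeing j \<sigma>\<^sub>0 B = {\<sigma>. \<sigma> permutes {..<2 * m} \<and> splits \<sigma> = j \<and>
     (\<forall>t\<in>B. \<sigma> (2 * t) = \<sigma>\<^sub>0 (2 * t) \<and> \<sigma> (2 * t + 1) = \<sigma>\<^sub>0 (2 * t + 1))}"

lemma finite_agreeing [simp]: "finite (agreeing j \<sigma>\<^sub>0 B)"
  by (rule finite_subset[OF _ finite_permutations[of "{..<2 * m}"]]) (auto simp: agreeing_def)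

lemma sum_block_type:
  assumes "\<sigma> permutes {..<2 * m}"
  shows "(\<Sum>t<m. block_type \<sigma> t) = a"
proof -
  have "(\<Sum>t<n. f (2 * t) + f (2 * t + 1)) = (\<Sum>h<2 * n. f h)" for f :: "nat \<Rightarrow> nat" and n
    by (induction n) auto
  from this[of "\<lambda>h. of_bool (\<sigma> h < a)" m]
  have "(\<Sum>t<m. block_type \<sigma> t) = (\<Sum>h<2 * m. of_bool (\<sigma> h < a))"
    by (simp add: block_type_def)
  also have "\<dots> = (\<Sum>h<2 * m. of_bool (h < a))"
    using sum.permute[OF assms, of "\<lambda>h. of_bool (h < a)"] unfolding o_def by (rule sym)
  also have "\<dots> = card {h. h < 2 * m \<and> h < a}"
    by (simp add: of_bool_def sum.If_cases Int_def)
  also have "{h. h < 2 * m \<and> h < a} = {..<a}" using a_le by auto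
  finally show ?thesis by simp
qed

text \<open>There are m blocks and a coloured items in total, so j split blocks leave (a - j) / 2
  blocks of type 2 and m - (a + j) / 2 of type 0. The polynomials are these counts as functions of
  j; their being linear is the source of the degree bound.\<close>

definition type_poly :: "nat \<Rightarrow> real poly" where
  "type_poly \<alpha> = (if \<alpha> = 0 then [:real m - a / 2, - 1 / 2:] else if \<alpha> = 1 then [:0, 1:] else [:a / 2, - 1 / 2:])"

lemma count_type_eq:
  assumes \<sigma>: "\<sigma> permutes {..<2 * m}" and "\<alpha> \<le> 2"
  shows "real (count_type \<alpha> \<sigma>) = poly (type_poly \<alpha>) (real (splits \<sigma>))"
proof -
  have le2: "block_type \<sigma> t \<le> 2" for t by (simp add: block_type_def)
  let ?S = "\<lambda>\<alpha>. {t. t < m \<and> block_type \<sigma> t = \<alpha>}"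
  have all: "{..<m} = ?S 0 \<union> (?S 1 \<union> ?S 2)"
  proof (intro set_eqI)
    fix t
    have "block_type \<sigma> t = 0 \<or> block_type \<sigma> t = 1 \<or> block_type \<sigma> t = 2"
      using le2[of t] by linarith
    then show "t \<in> {..<m} \<longleftrightarrow> t \<in> ?S 0 \<union> (?S 1 \<union> ?S 2)" by auto
  qed
  have "m = card (?S 0 \<union> (?S 1 \<union> ?S 2))" using arg_cong[OF all, of card] by simp
  also have "\<dots> = card (?S 0) + (card (?S 1) + card (?S 2))"
    by (subst card_Un_disjoint; (subst card_Un_disjoint)?) auto
  finally have 1: "m = count_type 0 \<sigma> + (splits \<sigma> + count_type 2 \<sigma>)"
    by (simp add: count_type_def)
  have "a = (\<Sum>t\<in>?S 0 \<union> (?S 1 \<union> ?S 2). block_type \<sigma> t)"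
    using sum_block_type[OF \<sigma>] all by simp
  also have "\<dots> = (\<Sum>t\<in>?S 0. block_type \<sigma> t) + ((\<Sum>t\<in>?S 1. block_type \<sigma> t) + (\<Sum>t\<in>?S 2. block_type \<sigma> t))"
    by (subst sum.union_disjoint; (subst sum.union_disjoint)?) auto
  finally have 2: "a = splits \<sigma> + 2 * count_type 2 \<sigma>"
    by (simp add: count_type_def)
  consider "\<alpha> = 0" | "\<alpha> = 1" | "\<alpha> = 2" using assms(2) by linarith
  then show ?thesis
    by cases (use 1 2 in \<open>auto simp: type_poly_def field_simps\<close>)
qed

section \<open>Revealing the content of one further block\<close>

context
  fixes j :: nat and \<sigma>\<^sub>0 :: "nat \<Rightarrow> nat" and B :: "nat set"
  assumes \<sigma>\<^sub>0: "\<sigma>\<^sub>0 permutes {..<2 * m}" and B: "B \<subseteq> {..<m}"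
begin

definition unused :: "nat set" where
  "unused = {..<2 * m} - (\<Union>t\<in>B. {\<sigma>\<^sub>0 (2 * t), \<sigma>\<^sub>0 (2 * t + 1)})"

definition placements :: "nat \<Rightarrow> nat \<Rightarrow> nat \<Rightarrow> (nat \<Rightarrow> nat) set" where
  "placements t w z = {\<sigma> \<in> agreeing j \<sigma>\<^sub>0 B. \<sigma> (2 * t) = w \<and> \<sigma> (2 * t + 1) = z}"

lemma conjugate_agreeing:
  assumes "\<sigma> \<in> agreeing j \<sigma>\<^sub>0 B"
    and \<beta>: "\<beta> permutes {..<2 * m}" "\<And>x. \<beta> x < a \<longleftrightarrow> x < a" "\<And>x. x \<notin> unused \<Longrightarrow> \<beta> x = x"
    and \<theta>: "\<theta> permutes {..<2 * m}" "\<And>t. t \<in> B \<Longrightarrow> \<theta> (2 * t) = 2 * t \<and> \<theta> (2 * t + 1) = 2 * t + 1"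
    and \<tau>: "\<tau> permutes {..<m}" "\<And>t. t < m \<Longrightarrow> {\<theta> (2 * t), \<theta> (2 * t + 1)} = {2 * \<tau> t, 2 * \<tau> t + 1}"
  shows "\<beta> \<circ> \<sigma> \<circ> \<theta> \<in> agreeing j \<sigma>\<^sub>0 B"
proof -
  have \<sigma>: "\<sigma> permutes {..<2 * m}" "splits \<sigma> = j"
    and ag: "\<And>t. t \<in> B \<Longrightarrow> \<sigma> (2 * t) = \<sigma>\<^sub>0 (2 * t) \<and> \<sigma> (2 * t + 1) = \<sigma>\<^sub>0 (2 * t + 1)"
    using assms(1) by (auto simp: agreeing_def)
  have ty: "block_type (\<beta> \<circ> \<sigma> \<circ> \<theta>) t = block_type \<sigma> (\<tau> t)" if "t < m" for t
    using \<tau>(2)[OF that] by (auto simp: block_type_def \<beta> doubleton_eq_iff)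
  have "bij_betw \<tau> {t. t < m \<and> block_type (\<beta> \<circ> \<sigma> \<circ> \<theta>) t = 1} {t. t < m \<and> block_type \<sigma> t = 1}"
  proof (rule bij_betw_imageI)
    show "inj_on \<tau> {t. t < m \<and> block_type (\<beta> \<circ> \<sigma> \<circ> \<theta>) t = 1}"
      using \<tau>(1) permutes_inj_on by blast
    show "\<tau> ` {t. t < m \<and> block_type (\<beta> \<circ> \<sigma> \<circ> \<theta>) t = 1} = {t. t < m \<and> block_type \<sigma> t = 1}"
    proof (intro equalityI subsetI)
      fix s assume "s \<in> \<tau> ` {t. t < m \<and> block_type (\<beta> \<circ> \<sigma> \<circ> \<theta>) t = 1}"
      then obtain t where t: "s = \<tau> t" "t < m" "block_type (\<beta> \<circ> \<sigma> \<circ> \<theta>) t = 1" by blast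
      then show "s \<in> {t. t < m \<and> block_type \<sigma> t = 1}"
        using ty[of t] permutes_in_image[OF \<tau>(1), of t] by simp
    next
      fix s assume s: "s \<in> {t. t < m \<and> block_type \<sigma> t = 1}"
      have "inv \<tau> s < m" using s permutes_in_image[OF permutes_inv[OF \<tau>(1)], of s] by auto
      then show "s \<in> \<tau> ` {t. t < m \<and> block_type (\<beta> \<circ> \<sigma> \<circ> \<theta>) t = 1}"
        using s ty[of "inv \<tau> s"] permutes_inverses[OF \<tau>(1)]
        by (intro image_eqI[where x = "inv \<tau> s"]) auto
    qed
  qed
  then have "splits (\<beta> \<circ> \<sigma> \<circ> \<theta>) = j"
    using \<sigma>(2) bij_betw_same_card by (fastforce simp: count_type_def)
  moreover have "\<beta> \<circ> \<sigma> \<circ> \<theta> permutes {..<2 * m}"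
    using \<beta>(1) \<sigma>(1) \<theta>(1) permutes_compose by blast
  moreover have "\<sigma>\<^sub>0 (2 * t) \<notin> unused \<and> \<sigma>\<^sub>0 (2 * t + 1) \<notin> unused" if "t \<in> B" for t
    using that by (auto simp: unused_def)
  ultimately show ?thesis
    using \<theta>(2) ag \<beta>(3) by (auto simp: agreeing_def)
qed

lemma card_placements_block:
  assumes "t < m" "t \<notin> B" "t' < m" "t' \<notin> B"
  shows "card (placements t w z) = card (placements t' w z)"
proof -
  define \<theta> where "\<theta> h = 2 * transpose t t' (h div 2) + h mod 2" for h
  have inv: "\<theta> \<circ> \<theta> = id" by (auto simp: \<theta>_def fun_eq_iff)
  have \<tau>: "transpose t t' permutes {..<m}" using assms by (intro permutes_swap_id) auto
  have "\<theta> permutes {..<2 * m}"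
  proof -
    have "\<theta> h = h" if "h \<notin> {..<2 * m}" for h
    proof -
      have "h div 2 \<notin> {..<m}" using that by auto
      then have "transpose t t' (h div 2) = h div 2" using \<tau> by (auto simp: permutes_def)
      then show "\<theta> h = h" by (simp add: \<theta>_def)
    qed
    moreover have "\<theta> (\<theta> h) = h" for h using inv by (metis comp_apply id_apply)
    ultimately show ?thesis unfolding permutes_def by metis
  qed
  then have ag: "id \<circ> \<sigma> \<circ> \<theta> \<in> agreeing j \<sigma>\<^sub>0 B" if "\<sigma> \<in> agreeing j \<sigma>\<^sub>0 B" for \<sigma>
    using that assms \<tau>
    by (intro conjugate_agreeing[where \<tau> = "transpose t t'"])
      (auto simp: permutes_id \<theta>_def Transposition.transpose_def)
  have "bij_betw (\<lambda>\<sigma>. \<sigma> \<circ> \<theta>) (placements t w z) (placements t' w z)"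
    by (rule bij_betw_byWitness[where f' = "\<lambda>\<sigma>. \<sigma> \<circ> \<theta>"])
      (use ag inv in \<open>auto simp: placements_def comp_assoc\<close>, auto simp: \<theta>_def)
  then show ?thesis by (rule bij_betw_same_card)
qed

lemma card_placements_flip:
  assumes "t < m" "t \<notin> B"
  shows "card (placements t w z) = card (placements t z w)"
proof -
  let ?\<theta> = "transpose (2 * t) (2 * t + 1)"
  have odd_ne: "Suc (2 * x) \<noteq> 2 * y" for x y :: nat by presburger
  have "?\<theta> permutes {..<2 * m}" using assms by (intro permutes_swap_id) auto
  then have ag: "id \<circ> \<sigma> \<circ> ?\<theta> \<in> agreeing j \<sigma>\<^sub>0 B" if "\<sigma> \<in> agreeing j \<sigma>\<^sub>0 B" for \<sigma>
    using that assms
    by (intro conjugate_agreeing[where \<tau> = id])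
      (auto simp: permutes_id Transposition.transpose_def odd_ne odd_ne[symmetric])
  have "bij_betw (\<lambda>\<sigma>. \<sigma> \<circ> ?\<theta>) (placements t w z) (placements t z w)"
    by (rule bij_betw_byWitness[where f' = "\<lambda>\<sigma>. \<sigma> \<circ> ?\<theta>"])
      (use ag in \<open>auto simp: placements_def comp_assoc\<close>)
  then show ?thesis by (rule bij_betw_same_card)
qed

lemma card_placements_item:
  assumes "x \<in> unused" "y \<in> unused" "x < a \<longleftrightarrow> y < a"
  shows "card (placements t w z) = card (placements t (transpose x y w) (transpose x y z))"
proof -
  let ?\<beta> = "transpose x y"
  have "?\<beta> permutes {..<2 * m}" using assms by (intro permutes_swap_id) (auto simp: unused_def)
  then have ag: "?\<beta> \<circ> \<sigma> \<circ> id \<in> agreeing j \<sigma>\<^sub>0 B" if "\<sigma> \<in> agreeing j \<sigma>\<^sub>0 B" for \<sigma>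
    using that assms
    by (intro conjugate_agreeing[where \<tau> = id]) (auto simp: permutes_id Transposition.transpose_def)
  have "bij_betw (\<lambda>\<sigma>. ?\<beta> \<circ> \<sigma>) (placements t w z) (placements t (?\<beta> w) (?\<beta> z))"
    by (rule bij_betw_byWitness[where f' = "\<lambda>\<sigma>. ?\<beta> \<circ> \<sigma>"])
      (use ag in \<open>auto simp: placements_def fun_eq_iff\<close>)
  then show ?thesis by (rule bij_betw_same_card)
qed

text \<open>Exchanging blocks, flipping a block and exchanging items of equal colour together
  connect any two ways of filling a free block that have the same type.\<close>

lemma card_placements:
  assumes t: "t < m" "t \<notin> B" "t' < m" "t' \<notin> B"
    and un: "w \<in> unused" "z \<in> unused" "w' \<in> unused" "z' \<in> unused"
    and ne: "w \<noteq> z" "w' \<noteq> z'"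
    and ty: "of_bool (w < a) + of_bool (z < a) = (of_bool (w' < a) + of_bool (z' < a) :: nat)"
  shows "card (placements t w z) = card (placements t' w' z')"
proof -
  have same: "card (placements t w z) = card (placements t w' z')"
    if un: "w \<in> unused" "z \<in> unused" and ne: "w \<noteq> z" and "w < a \<longleftrightarrow> w' < a" "z < a \<longleftrightarrow> z' < a" for w z
  proof -
    let ?z = "transpose w w' z"
    have z: "?z \<in> unused" "?z \<noteq> w'" "?z < a \<longleftrightarrow> z' < a"
      using that \<open>w' \<in> unused\<close> by (auto simp: Transposition.transpose_def)
    have "card (placements t w z) = card (placements t w' ?z)"
      using card_placements_item[of w w' t w z] that \<open>w' \<in> unused\<close> by simp
    also have "\<dots> = card (placements t w' z')"
      using card_placements_item[of ?z z' t w' ?z] z \<open>z' \<in> unused\<close> \<open>w' \<noteq> z'\<close> by simp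
    finally show ?thesis .
  qed
  have "card (placements t w z) = card (placements t w' z')"
  proof (cases "w < a \<longleftrightarrow> w' < a")
    case True
    then show ?thesis using same[of w z] un ne ty by (auto split: if_splits simp: of_bool_def)
  next
    \<comment> \<open>The types agree but the first items differ in colour, so both fillings are
      split with the coloured item in opposite slots; one flip aligns them.\<close>
    case False
    then show ?thesis using same[of z w] un ne ty card_placements_flip[OF t(1,2), of w z]
      by (auto split: if_splits simp: of_bool_def)
  qed
  also have "\<dots> = card (placements t' w' z')" using t by (rule card_placements_block)
  finally show ?thesis .
qed

definition openings :: "nat \<Rightarrow> (nat \<times> nat \<times> nat) set" where
  "openings \<alpha> = {(s, w, z). s < m \<and> s \<notin> B \<and> w \<in> unused \<and> z \<in> unused \<and> w \<noteq> z \<and>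
    of_bool (w < a) + of_bool (z < a) = \<alpha>}"

lemma finite_openings: "finite (openings \<alpha>)"
  by (rule finite_subset[of _ "{..<m} \<times> {..<2 * m} \<times> {..<2 * m}"]) (auto simp: openings_def unused_def)

lemma unused_block:
  assumes "\<sigma> permutes {..<2 * m}"
    and ag: "\<forall>t\<in>B. \<sigma> (2 * t) = \<sigma>\<^sub>0 (2 * t) \<and> \<sigma> (2 * t + 1) = \<sigma>\<^sub>0 (2 * t + 1)"
    and s: "s < m" "s \<notin> B"
  shows "\<sigma> (2 * s) \<in> unused \<and> \<sigma> (2 * s + 1) \<in> unused \<and> \<sigma> (2 * s) \<noteq> \<sigma> (2 * s + 1)"
proof -
  have eq: "\<sigma> x = \<sigma> y \<longleftrightarrow> x = y" for x y
    using permutes_inj[OF assms(1)] by (auto dest: injD)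
  have "\<sigma> (2 * s) < 2 * m" "\<sigma> (2 * s + 1) < 2 * m"
    using permutes_in_image[OF assms(1)] s by fastforce+
  moreover have "\<sigma> h \<noteq> \<sigma>\<^sub>0 (2 * t) \<and> \<sigma> h \<noteq> \<sigma>\<^sub>0 (2 * t + 1)" if "t \<in> B" "h div 2 = s" for t h
  proof -
    have "\<sigma>\<^sub>0 (2 * t) = \<sigma> (2 * t)" "\<sigma>\<^sub>0 (2 * t + 1) = \<sigma> (2 * t + 1)"
      using ag that(1) by simp_all
    moreover have "h \<noteq> 2 * t" "h \<noteq> 2 * t + 1" using that s(2) by auto
    ultimately show ?thesis using eq by metis
  qed
  ultimately show ?thesis by (auto simp: unused_def eq)
qed

lemma openings_mem:
  assumes "t < m" "t \<notin> B"
  shows "(t, \<sigma>\<^sub>0 (2 * t), \<sigma>\<^sub>0 (2 * t + 1)) \<in> openings (block_type \<sigma>\<^sub>0 t)"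
proof -
  have "\<sigma>\<^sub>0 (2 * t) \<in> unused \<and> \<sigma>\<^sub>0 (2 * t + 1) \<in> unused \<and> \<sigma>\<^sub>0 (2 * t) \<noteq> \<sigma>\<^sub>0 (2 * t + 1)"
    by (rule unused_block[OF \<sigma>\<^sub>0 _ assms]) blast
  then show ?thesis using assms unfolding openings_def block_type_def by blast
qed

text \<open>Count pairs of an opening and an arrangement realising it. By symmetry every opening of
  the given type is realised equally often; conversely an arrangement realises one opening for each
  block of that type not yet revealed. Since the number of openings does not depend on
  \<open>j\<close>, revealing a block contributes a factor linear in \<open>j\<close>.\<close>

lemma card_agreeing_insert:
  assumes t: "t < m" "t \<notin> B"
  shows "real (card (openings (block_type \<sigma>\<^sub>0 t))) * card (agreeing j \<sigma>\<^sub>0 (insert t B)) =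
       (poly (type_poly (block_type \<sigma>\<^sub>0 t)) j - card {s \<in> B. block_type \<sigma>\<^sub>0 s = block_type \<sigma>\<^sub>0 t}) *
       card (agreeing j \<sigma>\<^sub>0 B)"
proof -
  define \<alpha> where "\<alpha> = block_type \<sigma>\<^sub>0 t"
  have \<alpha>2: "\<alpha> \<le> 2" by (simp add: \<alpha>_def block_type_def)
  have finB: "finite B" using B finite_subset by blast
  let ?Z = "openings \<alpha>"
  have t0: "(t, \<sigma>\<^sub>0 (2 * t), \<sigma>\<^sub>0 (2 * t + 1)) \<in> ?Z"
    unfolding \<alpha>_def using t by (rule openings_mem)
  let ?n = "card {s \<in> B. block_type \<sigma>\<^sub>0 s = \<alpha>}"
  define N where "N \<sigma> = card {(s, w, z). (s, w, z) \<in> ?Z \<and> \<sigma> (2 * s) = w \<and> \<sigma> (2 * s + 1) = z}" for \<sigma>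
  have lhs: "(\<Sum>(s, w, z)\<in>?Z. card (placements s w z)) = card ?Z * card (agreeing j \<sigma>\<^sub>0 (insert t B))"
  proof -
    have "card (placements s w z) = card (agreeing j \<sigma>\<^sub>0 (insert t B))" if "(s, w, z) \<in> ?Z" for s w z
    proof -
      have "card (placements s w z) = card (placements t (\<sigma>\<^sub>0 (2 * t)) (\<sigma>\<^sub>0 (2 * t + 1)))"
        using that t0 by (intro card_placements) (auto simp: openings_def)
      also have "placements t (\<sigma>\<^sub>0 (2 * t)) (\<sigma>\<^sub>0 (2 * t + 1)) = agreeing j \<sigma>\<^sub>0 (insert t B)"
        by (auto simp: placements_def agreeing_def)
      finally show ?thesis .
    qed
    then have "(\<Sum>(s, w, z)\<in>?Z. card (placements s w z)) = (\<Sum>_\<in>?Z. card (agreeing j \<sigma>\<^sub>0 (insert t B)))"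
      by (intro sum.cong) auto
    then show ?thesis by simp
  qed
  have rhs: "(\<Sum>(s, w, z)\<in>?Z. card (placements s w z)) = (\<Sum>\<sigma>\<in>agreeing j \<sigma>\<^sub>0 B. N \<sigma>)"
    using card_swap_count[OF finite_openings finite_agreeing[of j \<sigma>\<^sub>0 B], of "\<lambda>(s, w, z) \<sigma>. \<sigma> (2 * s) = w \<and> \<sigma> (2 * s + 1) = z"]
    by (simp add: placements_def N_def case_prod_unfold)
  have N: "real (N \<sigma>) = poly (type_poly \<alpha>) j - ?n" if \<sigma>: "\<sigma> \<in> agreeing j \<sigma>\<^sub>0 B" for \<sigma>
  proof -
    have \<sigma>': "\<sigma> permutes {..<2 * m}" "splits \<sigma> = j"
      "\<forall>t\<in>B. \<sigma> (2 * t) = \<sigma>\<^sub>0 (2 * t) \<and> \<sigma> (2 * t + 1) = \<sigma>\<^sub>0 (2 * t + 1)"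
      using \<sigma> by (auto simp: agreeing_def)
    let ?A = "{s. s < m \<and> block_type \<sigma> s = \<alpha>}"
    have ty: "block_type \<sigma> s = block_type \<sigma>\<^sub>0 s" if "s \<in> B" for s
      using \<sigma>'(3) that by (simp add: block_type_def)
    have sub: "{s \<in> B. block_type \<sigma>\<^sub>0 s = \<alpha>} \<subseteq> ?A"
      using B ty by blast
    have img: "{(s, w, z). (s, w, z) \<in> ?Z \<and> \<sigma> (2 * s) = w \<and> \<sigma> (2 * s + 1) = z} =
        (\<lambda>s. (s, \<sigma> (2 * s), \<sigma> (2 * s + 1))) ` (?A - {s \<in> B. block_type \<sigma>\<^sub>0 s = \<alpha>})" (is "?L = ?R")
    proof (intro set_eqI)
      fix x :: "nat \<times> nat \<times> nat"
      obtain s w z where x: "x = (s, w, z)" by (cases x)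
      have "x \<in> ?L \<longleftrightarrow> s < m \<and> s \<notin> B \<and> block_type \<sigma> s = \<alpha> \<and> w = \<sigma> (2 * s) \<and> z = \<sigma> (2 * s + 1)"
        using unused_block[OF \<sigma>'(1,3), of s] by (auto simp: x openings_def block_type_def)
      also have "\<dots> \<longleftrightarrow> x \<in> ?R"
        using ty[of s] by (auto simp: x)
      finally show "x \<in> ?L \<longleftrightarrow> x \<in> ?R" .
    qed
    have "N \<sigma> =
        card (?A - {s \<in> B. block_type \<sigma>\<^sub>0 s = \<alpha>})"
      unfolding N_def img by (intro card_image inj_onI) auto
    also have "\<dots> = card ?A - ?n"
      by (rule card_Diff_subset[OF finite_subset[OF _ finB] sub]) blast
    finally have *: "N \<sigma> = card ?A - ?n" .
    have "?n \<le> card ?A"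
      by (rule card_mono[OF _ sub]) simp
    moreover have "real (card ?A) = poly (type_poly \<alpha>) j"
      using count_type_eq[OF \<sigma>'(1) \<alpha>2] \<sigma>'(2) by (simp add: count_type_def)
    ultimately show ?thesis using * by simp
  qed
  have "real (card ?Z) * card (agreeing j \<sigma>\<^sub>0 (insert t B)) = (\<Sum>\<sigma>\<in>agreeing j \<sigma>\<^sub>0 B. real (N \<sigma>))"
    by (simp only: of_nat_mult[symmetric] lhs[symmetric] rhs of_nat_sum)
  also have "\<dots> = (\<Sum>\<sigma>\<in>agreeing j \<sigma>\<^sub>0 B. poly (type_poly \<alpha>) j - ?n)"
    by (intro sum.cong refl N)
  finally show ?thesis by (simp add: \<alpha>_def)
qed

end

text \<open>The polynomial is a product of one linear factor per revealed block. At 0 the factors of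
  types 0 and 2 are \<open>m - a / 2 - r\<close> and \<open>a / 2 - r\<close> up to a positive
  constant, where \<open>r < k\<close> blocks of that type were revealed before; the hypotheses on
  \<open>k\<close> make them nonnegative.\<close>

lemma card_agreeing_poly:
  assumes \<sigma>\<^sub>0: "\<sigma>\<^sub>0 permutes {..<2 * m}"
    and k: "2 * k \<le> a" "a + 2 * k \<le> 2 * m"
    and B: "B \<subseteq> {..<m}" "card B \<le> k"
  obtains f :: "real poly" where "degree f \<le> k" "0 \<le> poly f 0"
    "\<And>j. real (card (agreeing j \<sigma>\<^sub>0 B)) = poly f (real j) * card (agreeing j \<sigma>\<^sub>0 {})"
proof -
  have "finite B" using B finite_subset by blast
  \<comment> \<open>The clause on vanishing carries the induction: a further split block brings a
    multiple of \<open>j - r\<close>, negative at 0 when \<open>r > 0\<close>. In that case an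
    earlier split block has already made the product zero there, and for \<open>r = 0\<close> the
    new factor does so itself.\<close>
  then have "\<exists>f :: real poly. degree f \<le> card B \<and> 0 \<le> poly f 0 \<and> ((\<exists>t\<in>B. block_type \<sigma>\<^sub>0 t = 1) \<longrightarrow> poly f 0 = 0) \<and>
    (\<forall>j. real (card (agreeing j \<sigma>\<^sub>0 B)) = poly f (real j) * card (agreeing j \<sigma>\<^sub>0 {}))"
    using B
  proof (induction B rule: finite_induct)
    case empty
    show ?case by (rule exI[of _ 1]) simp
  next
    case (insert t B)
    then have t: "t < m" "t \<notin> B" and B: "B \<subseteq> {..<m}" "card B < k" by auto
    obtain f :: "real poly" where f: "degree f \<le> card B" "0 \<le> poly f 0"
      "(\<exists>t\<in>B. block_type \<sigma>\<^sub>0 t = 1) \<longrightarrow> poly f 0 = 0"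
      "\<And>j. real (card (agreeing j \<sigma>\<^sub>0 B)) = poly f (real j) * card (agreeing j \<sigma>\<^sub>0 {})"
      using insert.IH B by auto
    define \<alpha> where "\<alpha> = block_type \<sigma>\<^sub>0 t"
    define r where "r = card {s \<in> B. block_type \<sigma>\<^sub>0 s = \<alpha>}"
    define c where "c = real (card (openings \<sigma>\<^sub>0 B \<alpha>))"
    have c: "c > 0"
      using openings_mem[OF \<sigma>\<^sub>0 B(1) t] finite_openings[OF \<sigma>\<^sub>0 B(1)]
      by (auto simp: c_def \<alpha>_def card_gt_0_iff)
    define g where "g = smult (1 / c) (type_poly \<alpha> - [:real r:])"
    have "r \<le> card B" unfolding r_def using insert.hyps by (intro card_mono) auto
    then have rk: "real r \<le> real k" using B by simp
    have k': "real k \<le> real a / 2" "real k \<le> real m - real a / 2" using k by linarith+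
    have g0: "0 \<le> poly g 0" if "\<alpha> \<noteq> 1"
      using that c rk k' by (auto simp: g_def type_poly_def)
    have r0: "\<exists>s\<in>B. block_type \<sigma>\<^sub>0 s = 1" if "\<alpha> = 1" "r \<noteq> 0"
    proof -
      have "{s \<in> B. block_type \<sigma>\<^sub>0 s = \<alpha>} \<noteq> {}" using that(2) unfolding r_def by (metis card.empty)
      then show ?thesis using that(1) by blast
    qed
    have g1: "poly (g * f) 0 = 0" if "\<alpha> = 1"
    proof (cases "r = 0")
      case True
      then show ?thesis using that by (simp add: g_def type_poly_def)
    next
      case False
      then show ?thesis using that r0 f(3) by simp
    qed
    have "degree (g * f) \<le> card (insert t B)"
    proof -
      have "degree (type_poly \<alpha> - [:real r:]) \<le> 1"
        by (intro degree_diff_le) (auto simp: type_poly_def)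
      then have "degree g \<le> 1" using c by (simp add: g_def)
      then show ?thesis using degree_mult_le[of g f] f(1) insert.hyps by simp
    qed
    moreover have "0 \<le> poly (g * f) 0" using g0 g1 f(2) by (cases "\<alpha> = 1") auto
    moreover have "poly (g * f) 0 = 0" if "\<exists>s\<in>insert t B. block_type \<sigma>\<^sub>0 s = 1"
    proof (cases "\<alpha> = 1")
      case True
      then show ?thesis by (rule g1)
    next
      case False
      then have "\<exists>s\<in>B. block_type \<sigma>\<^sub>0 s = 1" using that by (auto simp: \<alpha>_def)
      then show ?thesis using f(3) by simp
    qed
    moreover have "real (card (agreeing j \<sigma>\<^sub>0 (insert t B))) = poly (g * f) (real j) * card (agreeing j \<sigma>\<^sub>0 {})" for j
    proof -
      have "c * real (card (agreeing j \<sigma>\<^sub>0 (insert t B))) = (poly (type_poly \<alpha>) j - r) * card (agreeing j \<sigma>\<^sub>0 B)"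
        using card_agreeing_insert[OF \<sigma>\<^sub>0 B(1) t, of j] by (simp add: c_def \<alpha>_def r_def)
      then show ?thesis using c f(4)[of j] by (simp add: g_def field_simps)
    qed
    ultimately show ?case by blast
  qed
  then show ?thesis using that B(2) by (metis order.trans)
qed

lemma ex_splits:
  assumes "j \<le> a" "even (a - j)" "j + (a - j) div 2 \<le> m"
  obtains \<sigma> where "\<sigma> permutes {..<2 * m}" "splits \<sigma> = j"
proof -
  obtain q where q: "a = j + 2 * q" using assms by (metis evenE le_add_diff_inverse)
  then have jq: "j + q \<le> m" using assms by simp
  \<comment> \<open>The first \<open>j\<close> blocks get a coloured item in their first slot only,
    the next \<open>q\<close> blocks in both slots.\<close>
  define S where "S = (\<lambda>t. 2 * t) ` {..<j} \<union> {2 * j..<2 * (j + q)}"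
  have "card S = card ((\<lambda>t. 2 * t) ` {..<j}) + card {2 * j..<2 * (j + q)}"
    unfolding S_def by (intro card_Un_disjoint) auto
  then have "card S = a" using q by (simp add: card_image inj_on_def)
  moreover have SX: "S \<subseteq> {..<2 * m}" using jq by (auto simp: S_def)
  ultimately obtain \<sigma> where \<sigma>: "\<sigma> permutes {..<2 * m}" "\<sigma> ` S = {..<a}"
    using permutes_map_subset[of "{..<2 * m}" S "{..<a}"] SX a_le by auto
  have S: "\<sigma> h < a \<longleftrightarrow> h \<in> S" for h
    using \<sigma> permutes_inj[OF \<sigma>(1)] by (metis inj_image_mem_iff lessThan_iff)
  have ne: "Suc (2 * x) \<noteq> 2 * y" for x y :: nat by presburger
  have "2 * t \<in> S \<longleftrightarrow> t < j + q" "2 * t + 1 \<in> S \<longleftrightarrow> j \<le> t \<and> t < j + q" for t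
    by (auto simp: S_def ne image_iff)
  then have "block_type \<sigma> t = 1 \<longleftrightarrow> t < j" for t
    unfolding block_type_def S by (auto simp: of_bool_def)
  then have "splits \<sigma> = card {t. t < m \<and> t < j}" by (simp add: count_type_def)
  also have "{t. t < m \<and> t < j} = {..<j}" using jq by auto
  finally show ?thesis using that \<sigma>(1) by simp
qed

section \<open>Arrangements seen through few items\<close>

definition touched :: "nat set \<Rightarrow> (nat \<Rightarrow> nat) \<Rightarrow> nat set" where
  "touched W \<sigma> = (\<lambda>w. inv \<sigma> w div 2) ` W"

text \<open>More is recorded than the positions of the items in \<open>W\<close>: also their
  partners in the touched blocks. In this way the classes of equal view are sets of the form
  \<open>agreeing\<close> with at most \<open>card W\<close> revealed blocks.\<close>

definition local_view :: "nat set \<Rightarrow> (nat \<Rightarrow> nat) \<Rightarrow> nat \<Rightarrow> nat option" where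
  "local_view W \<sigma> h = (if h div 2 \<in> touched W \<sigma> then Some (\<sigma> h) else None)"

text \<open>Agreement on the blocks that \<open>W\<close> touches under
  \<open>\<sigma>\<^sub>0\<close> already determines the slots of all items of \<open>W\<close>, so
  no other block can be touched under \<sigma>.\<close>

lemma agreeing_touched:
  assumes "\<sigma> permutes {..<2 * m}" "\<sigma>\<^sub>0 permutes {..<2 * m}"
    and ag: "\<forall>t\<in>touched W \<sigma>\<^sub>0. \<sigma> (2 * t) = \<sigma>\<^sub>0 (2 * t) \<and> \<sigma> (2 * t + 1) = \<sigma>\<^sub>0 (2 * t + 1)"
  shows "touched W \<sigma> = touched W \<sigma>\<^sub>0" "\<And>w. w \<in> W \<Longrightarrow> \<sigma> (inv \<sigma>\<^sub>0 w) = w"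
    "\<And>h. h div 2 \<in> touched W \<sigma>\<^sub>0 \<Longrightarrow> \<sigma> h = \<sigma>\<^sub>0 h"
proof -
  show *: "\<sigma> h = \<sigma>\<^sub>0 h" if "h div 2 \<in> touched W \<sigma>\<^sub>0" for h
  proof -
    have "h = 2 * (h div 2) \<or> h = 2 * (h div 2) + 1" by presburger
    then show ?thesis using ag that by metis
  qed
  show w: "\<sigma> (inv \<sigma>\<^sub>0 w) = w" if "w \<in> W" for w
    using *[of "inv \<sigma>\<^sub>0 w"] that permutes_inverses[OF assms(2)] by (auto simp: touched_def)
  have "inv \<sigma> w = inv \<sigma>\<^sub>0 w" if "w \<in> W" for w
    using w[OF that] permutes_inv_eq[OF assms(1)] by metis
  then show "touched W \<sigma> = touched W \<sigma>\<^sub>0" by (simp add: touched_def)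
qed

lemma local_view_eq_iff:
  assumes "\<sigma> permutes {..<2 * m}" "\<sigma>\<^sub>0 permutes {..<2 * m}"
  shows "local_view W \<sigma> = local_view W \<sigma>\<^sub>0 \<longleftrightarrow>
    (\<forall>t\<in>touched W \<sigma>\<^sub>0. \<sigma> (2 * t) = \<sigma>\<^sub>0 (2 * t) \<and> \<sigma> (2 * t + 1) = \<sigma>\<^sub>0 (2 * t + 1))"
    (is "_ \<longleftrightarrow> ?R")
proof
  assume eq: "local_view W \<sigma> = local_view W \<sigma>\<^sub>0"
  have "\<sigma> h = \<sigma>\<^sub>0 h" if "h div 2 \<in> touched W \<sigma>\<^sub>0" for h
    using fun_cong[OF eq, of h] that by (simp add: local_view_def split: if_splits)
  then show ?R by simp
next
  assume ?R
  from agreeing_touched[OF assms this] show "local_view W \<sigma> = local_view W \<sigma>\<^sub>0"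
    by (auto simp: local_view_def fun_eq_iff)
qed

text \<open>The extrapolation weight of each odd level is spread evenly over the arrangements on it.
  Total mass and expected number of split blocks are extrapolations of the polynomials 1 and j, the
  latter calling for \<open>k \<ge> 1\<close>. For \<open>s\<close>, the arrangements are grouped by
  their local view, on which \<open>s\<close> is constant.\<close>

theorem pseudo_distribution:
  assumes "odd a" "2 * k + 1 \<le> a" "a + 2 * k + 1 \<le> 2 * m" "k \<ge> 1"
  obtains \<mu> :: "(nat \<Rightarrow> nat) \<Rightarrow> real" where
    "(\<Sum>\<sigma> | \<sigma> permutes {..<2 * m}. \<mu> \<sigma>) = 1"
    "(\<Sum>\<sigma> | \<sigma> permutes {..<2 * m}. \<mu> \<sigma> * splits \<sigma>) = 0"
    "\<And>s W. W \<subseteq> {..<2 * m} \<Longrightarrow> card W \<le> k \<Longrightarrow> (\<And>\<sigma>. \<sigma> permutes {..<2 * m} \<Longrightarrow> 0 \<le> s \<sigma>) \<Longrightarrow>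
      (\<And>\<tau> \<sigma>. \<tau> permutes {..<2 * m} \<Longrightarrow> \<sigma> permutes {..<2 * m} \<Longrightarrow> \<forall>w\<in>W. \<tau> w = w \<Longrightarrow> s (\<tau> \<circ> \<sigma>) = s \<sigma>) \<Longrightarrow>
      0 \<le> (\<Sum>\<sigma> | \<sigma> permutes {..<2 * m}. \<mu> \<sigma> * s \<sigma>)"
proof -
  let ?P = "{\<sigma>. \<sigma> permutes {..<2 * m}}"
  have finP: "finite ?P" by (simp add: finite_permutations)
  let ?J = "(\<lambda>i. real (2 * i + 1)) ` {..k}"
  have injJ: "inj_on (\<lambda>i. real (2 * i + 1)) {..k}" by (auto simp: inj_on_def)
  have "card ?J = Suc k" using card_image[OF injJ] by simp
  then obtain c where c: "\<And>f :: real poly. degree f \<le> k \<Longrightarrow> (\<Sum>x\<in>?J. c x * poly f x) = poly f 0"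
    using exists_extrapolation[of ?J k 0] by blast
  have c': "(\<Sum>i\<le>k. c (real (2 * i + 1)) * poly f (real (2 * i + 1))) = poly f 0" if "degree f \<le> k" for f
    using c[OF that] sum.reindex[OF injJ, of "\<lambda>x. c x * poly f x"] by (simp add: o_def)
  define \<Omega> where "\<Omega> i = {\<sigma>. \<sigma> permutes {..<2 * m} \<and> splits \<sigma> = 2 * i + 1}" for i
  have fin\<Omega>: "finite (\<Omega> i)" for i using finP by (auto simp: \<Omega>_def intro: finite_subset[OF _ finP])
  have N: "card (\<Omega> i) > 0" if "i \<le> k" for i
  proof -
    \<comment> \<open>Here the bounds on \<open>a\<close> are spent: \<open>2 * k + 1\<close> split
      blocks use up that many coloured and that many uncoloured items.\<close>
    have "2 * i + 1 \<le> a" "even (a - (2 * i + 1))" "(2 * i + 1) + (a - (2 * i + 1)) div 2 \<le> m"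
      using that assms by auto
    then obtain \<sigma> where "\<sigma> permutes {..<2 * m}" "splits \<sigma> = 2 * i + 1" by (rule ex_splits)
    then have "\<sigma> \<in> \<Omega> i" by (simp add: \<Omega>_def)
    then show ?thesis using fin\<Omega>[of i] by (auto simp: card_gt_0_iff)
  qed
  define w where "w i = c (real (2 * i + 1)) / card (\<Omega> i)" for i
  have w: "w i * card (\<Omega> i) = c (real (2 * i + 1))" if "i \<le> k" for i
    using N[OF that] by (simp add: w_def)
  \<comment> \<open>The levels are disjoint, so at most one summand is nonzero; writing \<mu> as a
    sum turns expectations into sums over levels by exchanging summations.\<close>
  define \<mu> where "\<mu> \<sigma> = (\<Sum>i\<le>k. if \<sigma> \<in> \<Omega> i then w i else 0)" for \<sigma>
  have expand: "(\<Sum>\<sigma>\<in>?P. \<mu> \<sigma> * s \<sigma>) = (\<Sum>i\<le>k. w i * (\<Sum>\<sigma>\<in>\<Omega> i. s \<sigma>))" for s :: "(nat \<Rightarrow> nat) \<Rightarrow> real"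
  proof -
    have "(\<Sum>\<sigma>\<in>?P. \<mu> \<sigma> * s \<sigma>) = (\<Sum>\<sigma>\<in>?P. \<Sum>i\<le>k. if \<sigma> \<in> \<Omega> i then w i * s \<sigma> else 0)"
      unfolding \<mu>_def sum_distrib_right by (intro sum.cong refl) auto
    also have "\<dots> = (\<Sum>i\<le>k. \<Sum>\<sigma>\<in>?P. if \<sigma> \<in> \<Omega> i then w i * s \<sigma> else 0)" by (rule sum.swap)
    also have "\<dots> = (\<Sum>i\<le>k. w i * (\<Sum>\<sigma>\<in>\<Omega> i. s \<sigma>))"
    proof (intro sum.cong refl)
      fix i
      have "?P \<inter> {\<sigma>. \<sigma> \<in> \<Omega> i} = \<Omega> i" by (auto simp: \<Omega>_def)
      then show "(\<Sum>\<sigma>\<in>?P. if \<sigma> \<in> \<Omega> i then w i * s \<sigma> else 0) = w i * (\<Sum>\<sigma>\<in>\<Omega> i. s \<sigma>)"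
        using finP by (simp add: sum.If_cases sum_distrib_left)
    qed
    finally show ?thesis .
  qed
  show ?thesis
  proof (rule that)
    have "(\<Sum>\<sigma>\<in>?P. \<mu> \<sigma>) = (\<Sum>i\<le>k. w i * card (\<Omega> i))"
      using expand[of "\<lambda>_. 1"] by simp
    also have "\<dots> = (\<Sum>i\<le>k. c (real (2 * i + 1)) * poly 1 (real (2 * i + 1)))"
      using w by (intro sum.cong) auto
    finally show "(\<Sum>\<sigma>\<in>?P. \<mu> \<sigma>) = 1" using c'[of 1] by simp
  next
    have "(\<Sum>\<sigma>\<in>?P. \<mu> \<sigma> * splits \<sigma>) = (\<Sum>i\<le>k. w i * (\<Sum>\<sigma>\<in>\<Omega> i. real (splits \<sigma>)))"
      by (rule expand)
    also have "\<dots> = (\<Sum>i\<le>k. c (real (2 * i + 1)) * poly [:0, 1:] (real (2 * i + 1)))"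
    proof (intro sum.cong refl)
      fix i assume "i \<in> {..k}"
      have "(\<Sum>\<sigma>\<in>\<Omega> i. real (splits \<sigma>)) = (\<Sum>\<sigma>\<in>\<Omega> i. real (2 * i + 1))"
        by (intro sum.cong) (auto simp: \<Omega>_def)
      also have "\<dots> = card (\<Omega> i) * real (2 * i + 1)" by simp
      finally show "w i * (\<Sum>\<sigma>\<in>\<Omega> i. real (splits \<sigma>)) = c (real (2 * i + 1)) * poly [:0, 1:] (real (2 * i + 1))"
        using w[of i] \<open>i \<in> {..k}\<close> by simp
    qed
    also have "\<dots> = 0" using c'[of "[:0, 1:]"] assms(4) by simp
    finally show "(\<Sum>\<sigma>\<in>?P. \<mu> \<sigma> * splits \<sigma>) = 0" .
  next
    fix s :: "(nat \<Rightarrow> nat) \<Rightarrow> real" and W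
    assume W: "W \<subseteq> {..<2 * m}" "card W \<le> k" and pos: "\<And>\<sigma>. \<sigma> permutes {..<2 * m} \<Longrightarrow> 0 \<le> s \<sigma>"
      and inv: "\<And>\<tau> \<sigma>. \<tau> permutes {..<2 * m} \<Longrightarrow> \<sigma> permutes {..<2 * m} \<Longrightarrow> \<forall>w\<in>W. \<tau> w = w \<Longrightarrow> s (\<tau> \<circ> \<sigma>) = s \<sigma>"
    let ?key = "local_view W"
    let ?K = "?key ` ?P"
    have "\<forall>\<kappa>\<in>?K. \<exists>\<sigma>. \<sigma> permutes {..<2 * m} \<and> ?key \<sigma> = \<kappa>" by auto
    then obtain r where r: "\<And>\<kappa>. \<kappa> \<in> ?K \<Longrightarrow> r \<kappa> permutes {..<2 * m} \<and> ?key (r \<kappa>) = \<kappa>"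
      by metis
    have finK: "finite ?K" using finP by simp
    \<comment> \<open>The value of \<open>f\<close> at an odd number is the share of the view class
      \<kappa> on that level.\<close>
    define Q where "Q \<kappa> f \<longleftrightarrow> degree f \<le> k \<and> 0 \<le> poly f 0 \<and>
        (\<forall>i. real (card {\<sigma> \<in> \<Omega> i. ?key \<sigma> = \<kappa>}) = poly f (real (2 * i + 1)) * card (\<Omega> i))" for \<kappa> and f :: "real poly"
    have "\<exists>f. Q \<kappa> f" if \<kappa>: "\<kappa> \<in> ?K" for \<kappa>
    proof -
      let ?B = "touched W (r \<kappa>)"
      have B1: "?B \<subseteq> {..<m}"
      proof
        fix t assume "t \<in> ?B"
        then obtain x where "x \<in> W" "t = inv (r \<kappa>) x div 2" by (auto simp: touched_def)
        moreover from this have "inv (r \<kappa>) x < 2 * m"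
          using W(1) permutes_in_image[OF permutes_inv[OF conjunct1[OF r[OF \<kappa>]]], of x] by auto
        ultimately show "t \<in> {..<m}" by auto
      qed
      have "finite W" using W(1) finite_subset by blast
      then have "card ?B \<le> k" unfolding touched_def using card_image_le W(2) order.trans by blast
      then obtain f :: "real poly" where f: "degree f \<le> k" "0 \<le> poly f 0"
        "\<And>j. real (card (agreeing j (r \<kappa>) ?B)) = poly f (real j) * card (agreeing j (r \<kappa>) {})"
        using card_agreeing_poly[of "r \<kappa>" k ?B] r[OF \<kappa>] assms B1 by auto
      have "{\<sigma> \<in> \<Omega> i. ?key \<sigma> = \<kappa>} = agreeing (2 * i + 1) (r \<kappa>) ?B" for i
        using local_view_eq_iff[of _ "r \<kappa>" W] r[OF \<kappa>] by (auto simp: \<Omega>_def agreeing_def)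
      moreover have "\<Omega> i = agreeing (2 * i + 1) (r \<kappa>) {}" for i
        by (auto simp: \<Omega>_def agreeing_def)
      ultimately have "\<forall>i. real (card {\<sigma> \<in> \<Omega> i. ?key \<sigma> = \<kappa>}) = poly f (real (2 * i + 1)) * card (\<Omega> i)"
        using f(3) by simp
      then show ?thesis using f(1,2) unfolding Q_def by blast
    qed
    then have "\<forall>\<kappa>\<in>?K. \<exists>f. Q \<kappa> f" ..
    then obtain f where f: "\<forall>\<kappa>\<in>?K. Q \<kappa> (f \<kappa>)" using bchoice[of ?K Q] by blast
    have fdeg: "degree (f \<kappa>) \<le> k" and f0: "0 \<le> poly (f \<kappa>) 0"
      and fcard: "real (card {\<sigma> \<in> \<Omega> i. ?key \<sigma> = \<kappa>}) = poly (f \<kappa>) (real (2 * i + 1)) * card (\<Omega> i)"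
      if "\<kappa> \<in> ?K" for \<kappa> i
      using f that unfolding Q_def by blast+
    have const: "s \<sigma> = s (r \<kappa>)" if "\<kappa> \<in> ?K" "\<sigma> permutes {..<2 * m}" "?key \<sigma> = \<kappa>" for \<kappa> \<sigma>
    proof -
      have r': "r \<kappa> permutes {..<2 * m}" "?key \<sigma> = ?key (r \<kappa>)" using r[OF that(1)] that by auto
      have "\<forall>w\<in>W. (\<sigma> \<circ> inv (r \<kappa>)) w = w"
        using agreeing_touched(2)[OF that(2) r'(1)] r'(2) local_view_eq_iff[OF that(2) r'(1)] by simp
      then have "s ((\<sigma> \<circ> inv (r \<kappa>)) \<circ> r \<kappa>) = s (r \<kappa>)"
        using that(2) r'(1) permutes_inv permutes_compose by (intro inv) blast+
      moreover have "(\<sigma> \<circ> inv (r \<kappa>)) \<circ> r \<kappa> = \<sigma>"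
        using r'(1) by (simp add: comp_assoc permutes_inv_o)
      ultimately show ?thesis by simp
    qed
    have group: "(\<Sum>\<sigma>\<in>\<Omega> i. s \<sigma>) = (\<Sum>\<kappa>\<in>?K. s (r \<kappa>) * (poly (f \<kappa>) (real (2 * i + 1)) * card (\<Omega> i)))" for i
    proof -
      have "(\<Sum>\<sigma>\<in>\<Omega> i. s \<sigma>) = (\<Sum>\<kappa>\<in>?K. \<Sum>\<sigma> | \<sigma> \<in> \<Omega> i \<and> ?key \<sigma> = \<kappa>. s \<sigma>)"
        using fin\<Omega> finK by (intro sum.group[symmetric]) (auto simp: \<Omega>_def)
      also have "\<dots> = (\<Sum>\<kappa>\<in>?K. \<Sum>\<sigma> | \<sigma> \<in> \<Omega> i \<and> ?key \<sigma> = \<kappa>. s (r \<kappa>))"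
        using const by (intro sum.cong refl) (auto simp: \<Omega>_def)
      also have "\<dots> = (\<Sum>\<kappa>\<in>?K. s (r \<kappa>) * (poly (f \<kappa>) (real (2 * i + 1)) * card (\<Omega> i)))"
      proof (intro sum.cong refl)
        fix \<kappa> assume \<kappa>: "\<kappa> \<in> ?K"
        have "real (card {\<sigma> \<in> \<Omega> i. ?key \<sigma> = \<kappa>}) = poly (f \<kappa>) (real (2 * i + 1)) * card (\<Omega> i)"
          by (rule fcard[OF \<kappa>])
        then show "(\<Sum>\<sigma> | \<sigma> \<in> \<Omega> i \<and> ?key \<sigma> = \<kappa>. s (r \<kappa>)) = s (r \<kappa>) * (poly (f \<kappa>) (real (2 * i + 1)) * card (\<Omega> i))"
          by (simp only: sum_constant mult.commute)
      qed
      finally show ?thesis .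
    qed
    have "(\<Sum>\<sigma>\<in>?P. \<mu> \<sigma> * s \<sigma>) = (\<Sum>i\<le>k. w i * (\<Sum>\<kappa>\<in>?K. s (r \<kappa>) * (poly (f \<kappa>) (real (2 * i + 1)) * card (\<Omega> i))))"
      unfolding expand group ..
    also have "\<dots> = (\<Sum>i\<le>k. \<Sum>\<kappa>\<in>?K. s (r \<kappa>) * (c (real (2 * i + 1)) * poly (f \<kappa>) (real (2 * i + 1))))"
      unfolding sum_distrib_left
    proof (intro sum.cong refl)
      fix i \<kappa> assume "i \<in> {..k}"
      then have "i \<le> k" by simp
      show "w i * (s (r \<kappa>) * (poly (f \<kappa>) (real (2 * i + 1)) * card (\<Omega> i))) =
          s (r \<kappa>) * (c (real (2 * i + 1)) * poly (f \<kappa>) (real (2 * i + 1)))"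
        unfolding w[OF \<open>i \<le> k\<close>, symmetric] by (simp only: mult_ac)
    qed
    also have "\<dots> = (\<Sum>\<kappa>\<in>?K. \<Sum>i\<le>k. s (r \<kappa>) * (c (real (2 * i + 1)) * poly (f \<kappa>) (real (2 * i + 1))))"
      by (rule sum.swap)
    \<comment> \<open>The extrapolation acts class by class: the weighted shares combine to the
      value of the share polynomial at 0, the level on which no arrangement exists.\<close>
    also have "\<dots> = (\<Sum>\<kappa>\<in>?K. s (r \<kappa>) * poly (f \<kappa>) 0)"
      unfolding sum_distrib_left[symmetric] by (intro sum.cong refl) (simp only: c' fdeg)
    also have "\<dots> \<ge> 0"
      using f0 r pos by (intro sum_nonneg mult_nonneg_nonneg) auto
    finally show "0 \<le> (\<Sum>\<sigma>\<in>?P. \<mu> \<sigma> * s \<sigma>)" .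
  qed
qed

end

section \<open>Cycles and the blossom inequality\<close>

lemma lookup_char_vec: "finite C \<Longrightarrow> Poly_Mapping.lookup (char_vec C) e = of_bool (e \<in> C)"
  by (simp add: char_vec_def lookup_sum lookup_single when_def)

text \<open>Two positions could yield the same edge only if each were the cyclic successor of the
  other, which \<open>3 \<le> l\<close> rules out.\<close>

lemma cycles_edge_inj:
  assumes "3 \<le> l" "length vs = l" "distinct vs"
  shows "inj_on (\<lambda>i. {vs ! i, vs ! (Suc i mod l)}) {..<l}"
proof (rule inj_onI)
  fix i j assume ij: "i \<in> {..<l}" "j \<in> {..<l}"
    and eq: "{vs ! i, vs ! (Suc i mod l)} = {vs ! j, vs ! (Suc j mod l)}"
  have nth: "vs ! x = vs ! y \<longleftrightarrow> x = y" if "x < l" "y < l" for x y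
    using assms that by (simp add: nth_eq_iff_index_eq)
  have "Suc i mod l < l" "Suc j mod l < l" using assms by auto
  then have "i = j \<or> (i = Suc j mod l \<and> Suc i mod l = j)"
    using eq ij by (auto simp: doubleton_eq_iff nth)
  then show "i = j" using ij assms(1) by (auto simp: mod_Suc split: if_splits)
qed

lemma finite_cycle: "C \<in> cycles l n \<Longrightarrow> finite C"
  by (auto simp: cycles_def)

lemma finite_cycles: "finite (cycles l n)"
proof (rule finite_subset)
  show "cycles l n \<subseteq> Pow (Pow {1..n})"
  proof
    fix C assume "C \<in> cycles l n"
    then obtain vs where vs: "3 \<le> l" "length vs = l" "set vs \<subseteq> {1..n}"
      "C = {{vs ! i, vs ! (Suc i mod l)} | i. i < l}" by (auto simp: cycles_def)
    have "vs ! i \<in> {1..n}" if "i < l" for i using vs that nth_mem by blast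
    moreover have "Suc i mod l < l" for i using vs by simp
    ultimately show "C \<in> Pow (Pow {1..n})" using vs(4) by blast
  qed
qed simp

lemma cycle_subset_complete_edges:
  assumes "C \<in> cycles l n"
  shows "C \<subseteq> complete_edges n"
proof -
  obtain vs where vs: "3 \<le> l" "length vs = l" "distinct vs" "set vs \<subseteq> {1..n}"
    "C = {{vs ! i, vs ! (Suc i mod l)} | i. i < l}" using assms by (auto simp: cycles_def)
  have "vs ! i \<in> {1..n}" if "i < l" for i using vs that nth_mem by blast
  moreover have "Suc i mod l < l" for i using vs by simp
  moreover have "vs ! i \<noteq> vs ! (Suc i mod l)" if "i < l" for i
    using that vs by (auto simp: nth_eq_iff_index_eq mod_Suc)
  ultimately show ?thesis
    unfolding vs(5) complete_edges_def by (auto simp: card_insert_if)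
qed

lemma image_cycle:
  assumes "C \<in> cycles l n" "\<pi> permutes {1..n}"
  shows "image \<pi> ` C \<in> cycles l n"
proof -
  obtain vs where vs: "3 \<le> l" "length vs = l" "distinct vs" "set vs \<subseteq> {1..n}"
    "C = {{vs ! i, vs ! (Suc i mod l)} | i. i < l}" using assms by (auto simp: cycles_def)
  have C: "image \<pi> ` C = {{map \<pi> vs ! i, map \<pi> vs ! (Suc i mod l)} | i. i < l}"
  proof -
    have "Suc i mod l < l" for i using vs by simp
    then have "{map \<pi> vs ! i, map \<pi> vs ! (Suc i mod l)} = \<pi> ` {vs ! i, vs ! (Suc i mod l)}" if "i < l" for i
      using that vs by simp
    then show ?thesis unfolding vs(5) by blast
  qed
  have "distinct (map \<pi> vs)" using vs permutes_inj_on[OF assms(2)] by (simp add: distinct_map)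
  moreover have "set (map \<pi> vs) \<subseteq> {1..n}" using vs(4) permutes_in_image[OF assms(2)] by fastforce
  ultimately show ?thesis
    unfolding cycles_def mem_Collect_eq using C vs(1,2)
    by (intro exI[of _ "map \<pi> vs"] conjI) (assumption | simp only: length_map)+
qed

text \<open>Summing \<open>card (e \<inter> H)\<close> along the cycle counts each of its nodes in
  \<open>H\<close> twice. Edges inside \<open>H\<close> contribute two each, so the edges with
  exactly one end in \<open>H\<close> are even in number.\<close>

lemma even_cut_cycle:
  assumes "C \<in> cycles l n"
  shows "even (card {e \<in> C. card (e \<inter> H) = 1})"
proof -
  obtain vs where vs: "3 \<le> l" "length vs = l" "distinct vs"
    "C = {{vs ! i, vs ! (Suc i mod l)} | i. i < l}" using assms by (auto simp: cycles_def)
  define edge where "edge i = {vs ! i, vs ! (Suc i mod l)}" for i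
  define h :: "nat \<Rightarrow> nat" where "h i = of_bool (vs ! i \<in> H)" for i
  have C: "C = edge ` {..<l}" using vs(4) by (auto simp: edge_def)
  have inj: "inj_on edge {..<l}" using cycles_edge_inj[OF vs(1-3)] by (simp add: edge_def[abs_def])
  have edge: "card (edge i \<inter> H) = h i + h (Suc i mod l)" if "i < l" for i
  proof -
    have "vs ! i \<noteq> vs ! (Suc i mod l)" using that vs by (auto simp: nth_eq_iff_index_eq mod_Suc)
    then show ?thesis by (auto simp: edge_def h_def Int_insert_left)
  qed
  have shift: "(\<Sum>i<l. h (Suc i mod l)) = (\<Sum>i<l. h i)"
  proof -
    have "inj_on (\<lambda>i. Suc i mod l) {..<l}"
      by (auto simp: inj_on_def mod_Suc split: if_splits)
    moreover have "(\<lambda>i. Suc i mod l) ` {..<l} \<subseteq> {..<l}" using vs(1) by auto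
    ultimately have "(\<lambda>i. Suc i mod l) ` {..<l} = {..<l}"
      by (simp add: endo_inj_surj)
    then show ?thesis
      using sum.reindex[OF \<open>inj_on (\<lambda>i. Suc i mod l) {..<l}\<close>, of h] by (simp add: o_def)
  qed
  have "(\<Sum>e\<in>C. card (e \<inter> H)) = (\<Sum>i<l. card (edge i \<inter> H))"
    unfolding C by (simp add: sum.reindex[OF inj] o_def)
  also have "\<dots> = (\<Sum>i<l. h i + h (Suc i mod l))" by (intro sum.cong) (auto simp: edge)
  also have "\<dots> = 2 * (\<Sum>i<l. h i)" by (simp add: sum.distrib shift)
  finally have "even (\<Sum>e\<in>C. card (e \<inter> H))" by simp
  moreover have "(\<Sum>e\<in>C. card (e \<inter> H)) = card {e \<in> C. card (e \<inter> H) = 1} + 2 * card {e \<in> C. card (e \<inter> H) = 2}"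
  proof -
    have "card (e \<inter> H) = of_bool (card (e \<inter> H) = 1) + 2 * of_bool (card (e \<inter> H) = 2)" if "e \<in> C" for e
      using that edge unfolding C by (auto simp: h_def)
    then have "(\<Sum>e\<in>C. card (e \<inter> H)) =
        (\<Sum>e\<in>C. of_bool (card (e \<inter> H) = 1)) + 2 * (\<Sum>e\<in>C. of_bool (card (e \<inter> H) = 2))"
      unfolding sum_distrib_left sum.distrib[symmetric] by (rule sum.cong[OF refl])
    moreover have "finite C" using C by simp
    ultimately show ?thesis by (simp add: of_bool_def sum.If_cases Int_def)
  qed
  ultimately show ?thesis by simp
qed

text \<open>
  Token \<open>u\<close> consists of the inner node \<open>2 * u + 1\<close> and the outer node \<open>2 * u + 2\<close>. In the reference
  cycle the first \<open>4 * m\<close> positions split into \<open>m\<close> blocks outer, inner, inner, outer, the \<open>t\<close>-th of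
  them formed by the tokens \<open>2 * t\<close> and \<open>2 * t + 1\<close>.
\<close>

definition ref_node :: "nat \<Rightarrow> nat \<Rightarrow> nat" where
  "ref_node m i =
     (if i < 4 * m \<and> i mod 4 = 0 then i + 2 else if i < 4 * m \<and> i mod 4 = 1 then i else i + 1)"

definition ref_cycle :: "nat \<Rightarrow> nat \<Rightarrow> nat set set" where
  "ref_cycle m l = {{ref_node m i, ref_node m (Suc i mod l)} | i. i < l}"

definition tooth :: "nat \<Rightarrow> nat set" where
  "tooth u = {2 * u + 1, 2 * u + 2}"

lemma inj_ref_node: "ref_node m i = ref_node m j \<Longrightarrow> i = j"
  unfolding ref_node_def by (simp split: if_splits; presburger)

lemma ref_cycle_in_cycles:
  assumes "3 \<le> l" "4 * m \<le> l" "l \<le> n"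
  shows "ref_cycle m l \<in> cycles l n"
proof -
  let ?vs = "map (ref_node m) [0..<l]"
  have eq: "ref_cycle m l = {{?vs ! i, ?vs ! (Suc i mod l)} | i. i < l}"
  proof -
    have "Suc i mod l < l" for i using assms by simp
    then have "{?vs ! i, ?vs ! (Suc i mod l)} = {ref_node m i, ref_node m (Suc i mod l)}" if "i < l" for i
      using that by simp
    then show ?thesis unfolding ref_cycle_def by blast
  qed
  have "distinct ?vs" by (auto simp: distinct_map inj_on_def dest: inj_ref_node)
  moreover have "1 \<le> ref_node m i \<and> ref_node m i \<le> n" if "i < l" for i
  proof -
    have "i + 2 \<le> n" if "i < 4 * m" "i mod 4 = 0" using that assms by presburger
    then show ?thesis using that assms by (auto simp: ref_node_def intro: Nat.gr0I)
  qed
  then have "set ?vs \<subseteq> {1..n}" by auto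
  ultimately show ?thesis
    unfolding cycles_def mem_Collect_eq using eq assms(1)
    by (intro exI[of _ ?vs] conjI) (assumption | simp)+
qed

lemma ref_node_block:
  assumes "t < m"
  shows "ref_node m (4 * t) = 4 * t + 2" "ref_node m (4 * t + 1) = 4 * t + 1"
    "ref_node m (4 * t + 2) = 4 * t + 3" "ref_node m (4 * t + 3) = 4 * t + 4"
proof -
  have "(4 * t + 1) mod 4 = 1" "(4 * t + 2) mod 4 = 2" "(4 * t + 3) mod 4 = 3" by presburger+
  then show "ref_node m (4 * t) = 4 * t + 2" "ref_node m (4 * t + 1) = 4 * t + 1"
    "ref_node m (4 * t + 2) = 4 * t + 3" "ref_node m (4 * t + 3) = 4 * t + 4"
    using assms by (simp_all add: ref_node_def)
qed

lemma ref_cycle_edges: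
  assumes "4 * m \<le> l"
  shows "u < 2 * m \<Longrightarrow> tooth u \<in> ref_cycle m l" "t < m \<Longrightarrow> {4 * t + 1, 4 * t + 3} \<in> ref_cycle m l"
proof -
  have edge: "{ref_node m i, ref_node m (Suc i)} \<in> ref_cycle m l" if "Suc i < l" for i
    using that unfolding ref_cycle_def by (intro CollectI exI[of _ i]) simp
  show "{4 * t + 1, 4 * t + 3} \<in> ref_cycle m l" if "t < m"
  proof -
    have "Suc (4 * t + 1) = 4 * t + 2" by simp
    then show ?thesis using edge[of "4 * t + 1"] that assms
      by (simp only: ref_node_block[OF that])
  qed
  show "tooth u \<in> ref_cycle m l" if u: "u < 2 * m"
  proof (cases "even u")
    case True
    then obtain t where t: "u = 2 * t" by blast
    then have "t < m" using u by simp
    then show ?thesis using edge[of "4 * t"] assms ref_node_block[of t m]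
      by (simp add: t tooth_def insert_commute)
  next
    case False
    then obtain t where t: "u = 2 * t + 1" by (metis oddE)
    then have tm: "t < m" using u by simp
    have Suc: "Suc (4 * t + 2) = 4 * t + 3" by simp
    have "2 * u + 1 = 4 * t + 3" "2 * u + 2 = 4 * t + 4" using t by simp_all
    moreover have "4 * t + 3 < l" using assms tm by simp
    ultimately show ?thesis using edge[of "4 * t + 2"]
      by (simp only: tooth_def Suc ref_node_block[OF tm])
  qed
qed

text \<open>Inner nodes occupy the two middle positions of a block, so both cycle edges at them stay
  within the block. Hence the edges linking consecutive blocks, and the tail of the cycle, never
  meet the handle.\<close>

lemma ref_cycle_inner:
  assumes e: "e \<in> ref_cycle m l" and x: "2 * v + 1 \<in> e" "v < 2 * m" and l: "4 * m \<le> l"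
  obtains (is_tooth) u where "u < 2 * m" "e = tooth u" | (inner) t where "t < m" "e = {4 * t + 1, 4 * t + 3}"
proof -
  obtain i where i: "i < l" "e = {ref_node m i, ref_node m (Suc i mod l)}"
    using e by (auto simp: ref_cycle_def)
  have pos: "\<exists>t<m. p = 4 * t + 1 \<or> p = 4 * t + 2" if "ref_node m p = 2 * v + 1" for p
  proof -
    have p: "p < 4 * m" "p mod 4 = 1 \<or> p mod 4 = 2"
      using that x(2) by (auto simp: ref_node_def split: if_splits; presburger)+
    define t where "t = p div 4"
    have "p = 4 * t + p mod 4" by (simp add: t_def)
    then show ?thesis using p by (intro exI[of _ t]) linarith
  qed
  have "ref_node m i = 2 * v + 1 \<or> ref_node m (Suc i mod l) = 2 * v + 1" using x i by auto
  then consider t where "t < m" "i = 4 * t" | t where "t < m" "i = 4 * t + 1" | t where "t < m" "i = 4 * t + 2"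
  proof
    assume "ref_node m i = 2 * v + 1"
    then show ?thesis using pos[of i] that by blast
  next
    assume "ref_node m (Suc i mod l) = 2 * v + 1"
    then obtain t where t: "t < m" "Suc i mod l = 4 * t + 1 \<or> Suc i mod l = 4 * t + 2" using pos by blast
    \<comment> \<open>A wrap-around would give position 0, which holds an outer node.\<close>
    then have "Suc i mod l = Suc i" using i(1) by (auto simp: mod_Suc split: if_splits)
    then show ?thesis using t that by auto
  qed
  then show ?thesis
  proof cases
    case 1
    have "Suc i mod l = 4 * t + 1" using 1 l by simp
    then have "e = tooth (2 * t)" using i(2) 1 ref_node_block[OF 1(1)] by (auto simp: tooth_def)
    then show ?thesis using is_tooth[of "2 * t"] 1 by simp
  next
    case 2
    have "Suc i mod l = 4 * t + 2" using 2 l by simp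
    then have "e = {4 * t + 1, 4 * t + 3}" using i(2) 2 ref_node_block[OF 2(1)] by auto
    then show ?thesis using inner 2 by blast
  next
    case 3
    have "Suc i mod l = 4 * t + 3" using 3 l by simp
    then have "e = tooth (2 * t + 1)" using i(2) 3 ref_node_block[OF 3(1)] by (auto simp: tooth_def)
    then show ?thesis using is_tooth[of "2 * t + 1"] 3 by simp
  qed
qed

section \<open>Token permutations as node permutations\<close>

definition lift_tokens :: "nat \<Rightarrow> (nat \<Rightarrow> nat) \<Rightarrow> nat \<Rightarrow> nat" where
  "lift_tokens N \<sigma> x = (if x \<in> {1..2 * N} then 2 * \<sigma> ((x - 1) div 2) + 1 + (x - 1) mod 2 else x)"

lemma lift_tokens_simps [simp]:
  assumes "u < N"
  shows "lift_tokens N \<sigma> (2 * u + 1) = 2 * \<sigma> u + 1" "lift_tokens N \<sigma> (2 * u + 2) = 2 * \<sigma> u + 2"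
  using assms by (auto simp: lift_tokens_def)

lemma token_node_cases:
  fixes x :: nat
  obtains u where "u < N" "x = 2 * u + 1" | u where "u < N" "x = 2 * u + 2" | "x \<notin> {1..2 * N}"
proof (cases "x \<in> {1..2 * N}")
  case True
  then have "(x - 1) div 2 < N" "x = 2 * ((x - 1) div 2) + 1 \<or> x = 2 * ((x - 1) div 2) + 2"
    by auto
  then show ?thesis using that by blast
qed (use that in blast)

lemma lift_tokens_comp:
  assumes "\<tau> permutes {..<N}"
  shows "lift_tokens N (\<sigma> \<circ> \<tau>) = lift_tokens N \<sigma> \<circ> lift_tokens N \<tau>"
proof
  fix x
  have \<tau>: "\<tau> u < N" if "u < N" for u using permutes_in_image[OF assms, of u] that by simp
  show "lift_tokens N (\<sigma> \<circ> \<tau>) x = (lift_tokens N \<sigma> \<circ> lift_tokens N \<tau>) x"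
  proof (cases x rule: token_node_cases[of N])
    case 1 then show ?thesis using \<tau> by (simp only: o_apply lift_tokens_simps)
  next
    case 2 then show ?thesis using \<tau> by (simp only: o_apply lift_tokens_simps)
  next
    case 3
    then have "lift_tokens N \<rho> x = x" for \<rho> by (simp only: lift_tokens_def if_False)
    then show ?thesis by simp
  qed
qed

lemma lift_tokens_id: "lift_tokens N id = id"
proof
  fix x show "lift_tokens N id x = id x"
    by (cases x rule: token_node_cases[of N]) (simp_all only: lift_tokens_simps id_apply, simp add: lift_tokens_def)
qed

lemma lift_tokens_permutes:
  assumes "\<sigma> permutes {..<N}" "2 * N \<le> n"
  shows "lift_tokens N \<sigma> permutes {1..n}"
proof -
  have "lift_tokens N \<sigma> \<circ> lift_tokens N (inv \<sigma>) = id" "lift_tokens N (inv \<sigma>) \<circ> lift_tokens N \<sigma> = id"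
    using assms(1) permutes_inv[OF assms(1)]
    by (simp_all add: lift_tokens_comp[symmetric] permutes_inv_o lift_tokens_id)
  then have "lift_tokens N \<sigma> (lift_tokens N (inv \<sigma>) x) = x" "lift_tokens N (inv \<sigma>) (lift_tokens N \<sigma> x) = x" for x
    by (metis comp_apply id_apply)+
  moreover have "lift_tokens N \<sigma> x = x" if "x \<notin> {1..n}" for x
    using that assms(2) by (auto simp: lift_tokens_def)
  ultimately show ?thesis unfolding permutes_def by metis
qed

text \<open>Exchanging two tokens exchanges two disjoint pairs of nodes; this exhibits the lift as
  even and prepares its factorisation into three-cycles.\<close>

lemma lift_tokens_transpose:
  assumes "u < N" "v < N"
  shows "lift_tokens N (transpose u v) = transpose (2 * u + 1) (2 * v + 1) \<circ> transpose (2 * u + 2) (2 * v + 2)"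
proof
  fix x
  have ne: "2 * w + 1 \<noteq> 2 * z + (2::nat)" for w z by presburger
  show "lift_tokens N (transpose u v) x = (transpose (2 * u + 1) (2 * v + 1) \<circ> transpose (2 * u + 2) (2 * v + 2)) x"
  proof (cases x rule: token_node_cases[of N])
    case (1 w)
    then have "lift_tokens N (transpose u v) x = 2 * transpose u v w + 1" by (simp only: lift_tokens_simps)
    then show ?thesis using 1 ne by (auto simp: Transposition.transpose_def)
  next
    case (2 w)
    then have "lift_tokens N (transpose u v) x = 2 * transpose u v w + 2" by (simp only: lift_tokens_simps)
    then show ?thesis using 2 ne[symmetric] by (auto simp: Transposition.transpose_def)
  next
    case 3
    then show ?thesis using assms by (auto simp: lift_tokens_def Transposition.transpose_def)
  qed
qed

section \<open>The blossom functional\<close>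

definition handle :: "nat \<Rightarrow> nat set" where
  "handle a = (\<lambda>u. 2 * u + 1) ` {..<a}"

definition cut_edges :: "nat \<Rightarrow> nat \<Rightarrow> nat set set" where
  "cut_edges a n = {e \<in> complete_edges n. card (e \<inter> handle a) = 1} - tooth ` {..<a}"

text \<open>The left-hand side of the 2-matching blossom inequality with an odd number of teeth: on
  an edge set it counts the non-tooth edges leaving the handle plus the missing teeth, and cycles
  have value at least 1.\<close>

definition blossom :: "nat \<Rightarrow> nat \<Rightarrow> (nat set \<Rightarrow>\<^sub>0 real) \<Rightarrow> real" where
  "blossom a n x = (\<Sum>e\<in>cut_edges a n. Poly_Mapping.lookup x e) +
     (\<Sum>u<a. 1 - Poly_Mapping.lookup x (tooth u))"

lemma finite_complete_edges: "finite (complete_edges n)"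
  by (rule finite_subset[of _ "Pow {1..n}"]) (auto simp: complete_edges_def)

lemma odd_mem_handle [simp]: "2 * u + 1 \<in> handle a \<longleftrightarrow> u < a" "Suc (2 * u) \<in> handle a \<longleftrightarrow> u < a"
  by (auto simp: handle_def)

lemma even_notin_handle [simp]: "2 * u + 2 \<notin> handle a" "Suc (Suc (2 * u)) \<notin> handle a"
  unfolding handle_def by (auto; presburger)+

lemma tooth_Int_handle: "tooth u \<inter> handle a = (if u < a then {2 * u + 1} else {})"
  by (auto simp: tooth_def)

lemma blossom_char_vec:
  assumes "C \<in> cycles l n"
  shows "blossom a n (char_vec C) = card (cut_edges a n \<inter> C) + card {u. u < a \<and> tooth u \<notin> C}"
proof -
  have "finite (cut_edges a n)" using finite_complete_edges by (simp add: cut_edges_def)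
  then have "(\<Sum>e\<in>cut_edges a n. of_bool (e \<in> C) :: real) = card (cut_edges a n \<inter> C)"
    by (simp add: of_bool_def sum.If_cases)
  moreover have "(\<Sum>u<a. 1 - of_bool (tooth u \<in> C) :: real) = (\<Sum>u<a. if tooth u \<notin> C then 1 else 0)"
    by (intro sum.cong) auto
  ultimately show ?thesis
    using finite_cycle[OF assms]
    by (simp add: blossom_def lookup_char_vec sum.If_cases Int_def del: sum_subtractf)
qed

text \<open>Value 0 would mean that the edges of the cycle leaving the handle are exactly the
  \<open>a\<close> teeth, an odd number, against \<open>even_cut_cycle\<close>.\<close>

lemma blossom_ge_1:
  assumes C: "C \<in> cycles l n" and "odd a"
  shows "blossom a n (char_vec C) \<ge> 1"
proof (rule ccontr)
  have finC: "finite C" using C by (rule finite_cycle)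
  assume "\<not> ?thesis"
  then have "card (cut_edges a n \<inter> C) = 0" "card {u. u < a \<and> tooth u \<notin> C} = 0"
    using blossom_char_vec[OF C, of a] by linarith+
  moreover have "finite (cut_edges a n \<inter> C)" "finite {u. u < a \<and> tooth u \<notin> C}"
    using finC by simp_all
  ultimately have 0: "cut_edges a n \<inter> C = {}" "{u. u < a \<and> tooth u \<notin> C} = {}"
    by (simp_all only: card_0_eq)
  have "{e \<in> C. card (e \<inter> handle a) = 1} = tooth ` {..<a}"
  proof
    show "{e \<in> C. card (e \<inter> handle a) = 1} \<subseteq> tooth ` {..<a}"
      using 0(1) cycle_subset_complete_edges[OF C] unfolding cut_edges_def by blast
    show "tooth ` {..<a} \<subseteq> {e \<in> C. card (e \<inter> handle a) = 1}"
      using 0(2) by (auto simp: tooth_Int_handle)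
  qed
  moreover have "inj tooth" by (auto simp: inj_def tooth_def doubleton_eq_iff)
  then have "card (tooth ` {..<a}) = a" by (simp add: card_image inj_on_def)
  ultimately show False using even_cut_cycle[OF C, of "handle a"] assms(2) by simp
qed

text \<open>Such a cycle contains every tooth, so only surplus cut edges count. By
  \<open>ref_cycle_inner\<close> these are edges joining the two inner nodes of a block, and such an
  edge crosses the handle exactly when the block is split.\<close>

lemma blossom_ref_cycle:
  assumes \<sigma>: "\<sigma> permutes {..<2 * m}" and a: "a \<le> 2 * m" and l: "3 \<le> l" "4 * m \<le> l" "l \<le> n"
  shows "blossom a n (char_vec (image (lift_tokens (2 * m) \<sigma>) ` ref_cycle m l)) = blocks.splits m a \<sigma>"
proof -
  interpret blocks m a using a by unfold_locales
  let ?L = "lift_tokens (2 * m) \<sigma>"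
  let ?C = "image ?L ` ref_cycle m l"
  have L: "?L permutes {1..n}" using \<sigma> l by (intro lift_tokens_permutes) auto
  have C: "?C \<in> cycles l n" using l L by (intro image_cycle ref_cycle_in_cycles)
  have L_tooth: "?L ` tooth u = tooth (\<sigma> u)" if "u < 2 * m" for u
    using that unfolding tooth_def by (simp only: image_insert image_empty lift_tokens_simps)
  have L_inner: "?L ` {4 * t + 1, 4 * t + 3} = {2 * \<sigma> (2 * t) + 1, 2 * \<sigma> (2 * t + 1) + 1}" if "t < m" for t
  proof -
    have eq: "4 * t + 1 = 2 * (2 * t) + 1" "4 * t + 3 = 2 * (2 * t + 1) + 1" by simp_all
    have "2 * t < 2 * m" "2 * t + 1 < 2 * m" using that by simp_all
    then show ?thesis unfolding eq by (simp only: image_insert image_empty lift_tokens_simps)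
  qed
  have "tooth u \<in> ?C" if "u < a" for u
  proof -
    have "inv \<sigma> u < 2 * m"
      using that a permutes_in_image[OF permutes_inv[OF \<sigma>], of u] by simp
    then show ?thesis
      using L_tooth[of "inv \<sigma> u"] ref_cycle_edges(1)[OF l(2)] permutes_inverses(1)[OF \<sigma>]
      by (metis image_eqI)
  qed
  then have teeth: "{u. u < a \<and> tooth u \<notin> ?C} = {}" by blast
  let ?g = "\<lambda>t. {2 * \<sigma> (2 * t) + 1, 2 * \<sigma> (2 * t + 1) + 1}"
  have \<sigma>eq: "\<sigma> x = \<sigma> y \<longleftrightarrow> x = y" for x y using permutes_inj[OF \<sigma>] by (auto dest: injD)
  have odd_ne: "2 * x \<noteq> Suc (2 * y)" for x y :: nat by presburger
  have g_card: "card (?g t \<inter> handle a) = block_type \<sigma> t" for t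
    by (auto simp: block_type_def Int_insert_left \<sigma>eq)
  have g_tooth: "?g t \<noteq> tooth u" for t u
    by (auto simp: tooth_def doubleton_eq_iff odd_ne)
  have "cut_edges a n \<inter> ?C = ?g ` {t. t < m \<and> block_type \<sigma> t = 1}"
  proof
    show "?g ` {t. t < m \<and> block_type \<sigma> t = 1} \<subseteq> cut_edges a n \<inter> ?C"
    proof
      fix e assume "e \<in> ?g ` {t. t < m \<and> block_type \<sigma> t = 1}"
      then obtain t where t: "t < m" "block_type \<sigma> t = 1" "e = ?g t" by blast
      have "e \<in> ?C" using L_inner[OF t(1)] ref_cycle_edges(2)[OF l(2) t(1)] t(3) by (metis image_eqI)
      then show "e \<in> cut_edges a n \<inter> ?C"
        using t g_card[of t] g_tooth[of t] cycle_subset_complete_edges[OF C] unfolding cut_edges_def by auto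
    qed
  next
    show "cut_edges a n \<inter> ?C \<subseteq> ?g ` {t. t < m \<and> block_type \<sigma> t = 1}"
    proof
      fix e assume "e \<in> cut_edges a n \<inter> ?C"
      then obtain e0 where e0: "e0 \<in> ref_cycle m l" "e = ?L ` e0" and e1: "card (e \<inter> handle a) = 1" "e \<notin> tooth ` {..<a}"
        by (auto simp: cut_edges_def)
      \<comment> \<open>A cut edge has an inner node of a coloured token as an end; pulled back to
        the reference cycle it falls under \<open>ref_cycle_inner\<close>.\<close>
      then have "e \<inter> handle a \<noteq> {}" by auto
      then obtain x u where x: "x \<in> e0" "?L x = 2 * u + 1" "u < a"
        unfolding e0(2) handle_def by auto
      have iu: "inv \<sigma> u < 2 * m"
        using x(3) a permutes_in_image[OF permutes_inv[OF \<sigma>], of u] by simp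
      then have "?L (2 * inv \<sigma> u + 1) = ?L x"
        using x(2) permutes_inverses(1)[OF \<sigma>] by (simp only: lift_tokens_simps)
      then have "2 * inv \<sigma> u + 1 \<in> e0" using permutes_inj[OF L] x(1) by (metis injD)
      from e0(1) this iu l(2) show "e \<in> ?g ` {t. t < m \<and> block_type \<sigma> t = 1}"
      proof (cases rule: ref_cycle_inner)
        case (is_tooth v)
        then have "e = tooth (\<sigma> v)" using L_tooth e0(2) by simp
        then show ?thesis using e1 by (auto simp: tooth_Int_handle split: if_splits)
      next
        case (inner t)
        then have "e = ?g t" using L_inner e0(2) by simp
        moreover from this have "block_type \<sigma> t = 1" using e1(1) g_card[of t] by (simp only:)
        ultimately show ?thesis using inner(1) by blast
      qed
    qed
  qed
  moreover have "inj_on ?g {t. t < m \<and> block_type \<sigma> t = 1}"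
    by (auto simp: inj_on_def doubleton_eq_iff \<sigma>eq odd_ne)
  ultimately have "card (cut_edges a n \<inter> ?C) = splits \<sigma>"
    by (simp only: card_image count_type_def)
  then show ?thesis using blossom_char_vec[OF C, of a] teeth by simp
qed

section \<open>Equivariant lifts\<close>

lemma lookup_scaleR [simp]: "Poly_Mapping.lookup (c *\<^sub>R x) i = c * Poly_Mapping.lookup x i"
proof -
  have "finite {i. c *\<^sub>R Poly_Mapping.lookup x i \<noteq> 0}"
    by (rule finite_subset[OF _ finite_lookup[of x]]) auto
  then show ?thesis by (simp add: scaleR_poly_mapping_def)
qed

lemma coord_space_iff: "x \<in> coord_space I \<longleftrightarrow> (\<forall>i. i \<notin> I \<longrightarrow> Poly_Mapping.lookup x i = 0)"
  by (auto simp: coord_space_def in_keys_iff)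

lemma coord_space_sum:
  assumes "\<And>x. x \<in> X \<Longrightarrow> Y x \<in> coord_space I"
  shows "(\<Sum>x\<in>X. w x *\<^sub>R Y x) \<in> coord_space I"
  using assms by (simp add: coord_space_iff lookup_sum sum.neutral)

lemma lookup_permute_coords:
  assumes "bij \<sigma>"
  shows "Poly_Mapping.lookup (permute_coords \<sigma> y) i = Poly_Mapping.lookup y (inv \<sigma> i)"
proof -
  have "inj (inv \<sigma>)" using assms by (simp add: bij_imp_bij_inv bij_is_inj)
  then show ?thesis by (simp add: permute_coords_def map_key.rep_eq)
qed

lemma permute_coords_comp:
  assumes "bij \<sigma>" "bij \<tau>"
  shows "permute_coords (\<sigma> \<circ> \<tau>) y = permute_coords \<sigma> (permute_coords \<tau> y)"
  using assms by (intro poly_mapping_eqI) (simp add: lookup_permute_coords bij_comp o_inv_distrib bij_is_inj bij_is_surj)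

lemma bij_image:
  assumes "bij \<pi>"
  shows "bij (image \<pi>)" "inv (image \<pi>) = image (inv \<pi>)"
proof -
  have 1: "image \<pi> \<circ> image (inv \<pi>) = id" "image (inv \<pi>) \<circ> image \<pi> = id"
    using assms by (auto simp: fun_eq_iff image_image bij_is_inj bij_is_surj surj_f_inv_f)
  then show "bij (image \<pi>)" by (metis o_bij)
  show "inv (image \<pi>) = image (inv \<pi>)" using 1 by (metis inv_unique_comp)
qed

lemma permute_char_vec:
  assumes "bij \<pi>" "finite C"
  shows "permute_coords (image \<pi>) (char_vec C) = char_vec (image \<pi> ` C)"
proof (rule poly_mapping_eqI)
  fix e
  have "\<pi> ` inv \<pi> ` e = e" "inv \<pi> ` \<pi> ` d = d" for d
    using assms(1) by (simp_all add: image_image bij_is_inj bij_is_surj surj_f_inv_f)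
  then have "inv \<pi> ` e \<in> C \<longleftrightarrow> e \<in> image \<pi> ` C"
    by (metis imageE image_eqI)
  then show "Poly_Mapping.lookup (permute_coords (image \<pi>) (char_vec C)) e =
      Poly_Mapping.lookup (char_vec (image \<pi> ` C)) e"
    using assms by (simp add: lookup_permute_coords bij_image lookup_char_vec)
qed

section \<open>Slack functions and affine combinations\<close>

definition slack :: "lin_system \<Rightarrow> nat \<Rightarrow> (nat \<Rightarrow>\<^sub>0 real) \<Rightarrow> real" where
  "slack F i y = b_le F i - (\<Sum>j<n_vars F. A_le F i j * Poly_Mapping.lookup y j)"

lemma slack_nonneg: "y \<in> solutions F \<Longrightarrow> i < n_ineqs F \<Longrightarrow> 0 \<le> slack F i y"
  by (auto simp: slack_def solutions_def)

lemma slack_affine: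
  assumes "(\<Sum>x\<in>X. w x) = 1"
  shows "slack F i (\<Sum>x\<in>X. w x *\<^sub>R Y x) = (\<Sum>x\<in>X. w x * slack F i (Y x))"
proof -
  have "(\<Sum>j<n_vars F. A_le F i j * (\<Sum>x\<in>X. w x * Poly_Mapping.lookup (Y x) j)) =
      (\<Sum>x\<in>X. w x * (\<Sum>j<n_vars F. A_le F i j * Poly_Mapping.lookup (Y x) j))"
    unfolding sum_distrib_left by (subst sum.swap) (simp add: mult_ac)
  moreover have "b_le F i = (\<Sum>x\<in>X. w x * b_le F i)"
    using assms by (simp add: sum_distrib_right[symmetric])
  ultimately show ?thesis
    by (simp add: slack_def lookup_sum right_diff_distrib sum_subtractf)
qed

text \<open>Equations survive every affine combination, and feasibility for the inequalities is
  asked of averaged slacks only. The weights may therefore be negative, as \<mu> requires; the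
  uniform averages of the equivariant lift are the other use.\<close>

lemma affine_combination_solution:
  assumes "(\<Sum>x\<in>X. w x) = 1" and Y: "\<And>x. x \<in> X \<Longrightarrow> Y x \<in> solutions F"
    and pos: "\<And>i. i < n_ineqs F \<Longrightarrow> 0 \<le> (\<Sum>x\<in>X. w x * slack F i (Y x))"
  shows "(\<Sum>x\<in>X. w x *\<^sub>R Y x) \<in> solutions F"
proof -
  have "(\<Sum>j<n_vars F. A_eq F i j * (\<Sum>x\<in>X. w x * Poly_Mapping.lookup (Y x) j)) = b_eq F i"
    if "i < n_eqs F" for i
  proof -
    have "(\<Sum>j<n_vars F. A_eq F i j * (\<Sum>x\<in>X. w x * Poly_Mapping.lookup (Y x) j)) =
        (\<Sum>x\<in>X. w x * (\<Sum>j<n_vars F. A_eq F i j * Poly_Mapping.lookup (Y x) j))"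
      unfolding sum_distrib_left by (subst sum.swap) (simp add: mult_ac)
    also have "\<dots> = (\<Sum>x\<in>X. w x * b_eq F i)"
      using Y that by (intro sum.cong) (auto simp: solutions_def)
    finally show ?thesis using assms(1) by (simp add: sum_distrib_right[symmetric])
  qed
  moreover have "0 \<le> slack F i (\<Sum>x\<in>X. w x *\<^sub>R Y x)" if "i < n_ineqs F" for i
    unfolding slack_affine[OF assms(1)] using pos[OF that] .
  moreover have "(\<Sum>x\<in>X. w x *\<^sub>R Y x) \<in> coord_space {..<n_vars F}"
    using Y by (intro coord_space_sum) (auto simp: solutions_def)
  ultimately show ?thesis by (auto simp: solutions_def slack_def lookup_sum)
qed

lemma affine_map_combination:
  assumes "affine_map_between J I p" "(\<Sum>x\<in>X. w x) = 1" "\<And>x. x \<in> X \<Longrightarrow> Y x \<in> coord_space J"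
  shows "p (\<Sum>x\<in>X. w x *\<^sub>R Y x) = (\<Sum>x\<in>X. w x *\<^sub>R p (Y x))"
proof -
  obtain h t where h: "linear h" "\<And>y. y \<in> coord_space J \<Longrightarrow> p y = h y + t"
    using assms(1) by (auto simp: affine_map_between_def)
  have "p (\<Sum>x\<in>X. w x *\<^sub>R Y x) = h (\<Sum>x\<in>X. w x *\<^sub>R Y x) + t"
    using assms(3) by (intro h coord_space_sum)
  also have "h (\<Sum>x\<in>X. w x *\<^sub>R Y x) = (\<Sum>x\<in>X. w x *\<^sub>R h (Y x))"
    using h(1) by (simp add: linear_sum linear_scale)
  also have "\<dots> + t = (\<Sum>x\<in>X. w x *\<^sub>R (h (Y x) + t))"
    using assms(2) by (simp add: scaleR_add_right sum.distrib scaleR_left.sum[symmetric])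
  also have "\<dots> = (\<Sum>x\<in>X. w x *\<^sub>R p (Y x))" using assms(3) h(2) by (intro sum.cong) auto
  finally show ?thesis .
qed

lemma slack_permute:
  assumes "\<kappa> permutes {..<n_vars F}"
    and "b_le F i' = b_le F i" "\<And>j. j < n_vars F \<Longrightarrow> A_le F i' (\<kappa> j) = A_le F i j"
  shows "slack F i' (permute_coords \<kappa> y) = slack F i y"
proof -
  have "(\<Sum>j<n_vars F. A_le F i' j * Poly_Mapping.lookup y (inv \<kappa> j)) =
      (\<Sum>j<n_vars F. A_le F i' (\<kappa> j) * Poly_Mapping.lookup y (inv \<kappa> (\<kappa> j)))"
    using sum.permute[OF assms(1), of "\<lambda>j. A_le F i' j * Poly_Mapping.lookup y (inv \<kappa> j)"] by (simp add: o_def)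
  then show ?thesis
    using assms by (simp add: slack_def lookup_permute_coords permutes_bij permutes_inverses)
qed

text \<open>Symmetry is prescribed for the rows of the system; each row evaluated at the permuted
  point is another row evaluated at \<open>y\<close>, so the solution set is preserved.\<close>

lemma permute_solution:
  assumes \<kappa>: "\<kappa> permutes {..<n_vars F}"
    and \<rho>: "\<rho> permutes {..<n_eqs F}" "\<forall>i<n_eqs F. b_eq F (\<rho> i) = b_eq F i \<and> (\<forall>j<n_vars F. A_eq F (\<rho> i) (\<kappa> j) = A_eq F i j)"
    and \<rho>': "\<rho>' permutes {..<n_ineqs F}" "\<forall>i<n_ineqs F. b_le F (\<rho>' i) = b_le F i \<and> (\<forall>j<n_vars F. A_le F (\<rho>' i) (\<kappa> j) = A_le F i j)"
    and y: "y \<in> solutions F"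
  shows "permute_coords \<kappa> y \<in> solutions F"
proof -
  have look: "Poly_Mapping.lookup (permute_coords \<kappa> y) j = Poly_Mapping.lookup y (inv \<kappa> j)" for j
    using \<kappa> by (simp add: lookup_permute_coords permutes_bij)
  have "permute_coords \<kappa> y \<in> coord_space {..<n_vars F}"
    using y permutes_inv[OF \<kappa>] by (auto simp: solutions_def coord_space_iff look permutes_def)
  moreover have "(\<Sum>j<n_vars F. A_eq F i j * Poly_Mapping.lookup (permute_coords \<kappa> y) j) = b_eq F i"
    if i: "i < n_eqs F" for i
  proof -
    have i': "inv \<rho> i < n_eqs F" using permutes_in_image[OF permutes_inv[OF \<rho>(1)], of i] i by simp
    have \<rho>i: "\<rho> (inv \<rho> i) = i" using permutes_inverses(1)[OF \<rho>(1)] .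
    have "(\<Sum>j<n_vars F. A_eq F i j * Poly_Mapping.lookup (permute_coords \<kappa> y) j) =
        (\<Sum>j<n_vars F. A_eq F i (\<kappa> j) * Poly_Mapping.lookup y j)"
      using sum.permute[OF \<kappa>, of "\<lambda>j. A_eq F i j * Poly_Mapping.lookup (permute_coords \<kappa> y) j"]
      by (simp add: o_def look permutes_inverses[OF \<kappa>])
    also have "\<dots> = (\<Sum>j<n_vars F. A_eq F (inv \<rho> i) j * Poly_Mapping.lookup y j)"
      using \<rho>(2) i' \<rho>i by (intro sum.cong refl) (metis lessThan_iff)
    also have "\<dots> = b_eq F i" using y i' \<rho>(2) \<rho>i by (auto simp: solutions_def)
    finally show ?thesis .
  qed
  moreover have "0 \<le> slack F i (permute_coords \<kappa> y)" if i: "i < n_ineqs F" for i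
  proof -
    have i': "inv \<rho>' i < n_ineqs F" using permutes_in_image[OF permutes_inv[OF \<rho>'(1)], of i] i by simp
    have "slack F (\<rho>' (inv \<rho>' i)) (permute_coords \<kappa> y) = slack F (inv \<rho>' i) y"
      using \<kappa> \<rho>'(2) i' by (intro slack_permute) auto
    then show ?thesis using slack_nonneg[OF y i'] permutes_inverses(1)[OF \<rho>'(1)] by simp
  qed
  ultimately show ?thesis by (auto simp: solutions_def slack_def)
qed

text \<open>The variable permutations chosen for the node permutations need not form a homomorphism,
  so a lift cannot simply be transported along them. The set of all admissible triples is closed
  under composition, and averaging over it makes the choice disappear. The resulting row permutation
  is the same for all cycles.\<close>

lemma equivariant_lift:
  assumes ext: "extended_formulation (complete_edges n) (cycle_polytope l n) F p"
    and sym: "symmetric_formulation (node_actions n) F p"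
  obtains Y where "\<And>C. C \<in> cycles l n \<Longrightarrow> Y C \<in> solutions F"
    "\<And>C. C \<in> cycles l n \<Longrightarrow> p (Y C) = char_vec C"
    "\<And>\<pi>. \<pi> permutes {1..n} \<Longrightarrow> \<exists>\<rho>. \<rho> permutes {..<n_ineqs F} \<and>
      (\<forall>C\<in>cycles l n. \<forall>i<n_ineqs F. slack F (\<rho> i) (Y (image \<pi> ` C)) = slack F i (Y C))"
proof -
  let ?S = "solutions F" and ?V = "{1..n}"
  have aff: "affine_map_between {..<n_vars F} (complete_edges n) p" and img: "p ` ?S = cycle_polytope l n"
    using ext by (auto simp: extended_formulation_def)
  have "\<exists>y. y \<in> ?S \<and> p y = char_vec C" if "C \<in> cycles l n" for C
  proof -
    have "char_vec C \<in> cycle_polytope l n"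
      using that by (auto simp: cycle_polytope_def intro: hull_inc)
    then have "char_vec C \<in> p ` ?S" by (simp only: img)
    then show ?thesis by auto
  qed
  then obtain y\<^sub>0 where y\<^sub>0: "\<And>C. C \<in> cycles l n \<Longrightarrow> y\<^sub>0 C \<in> ?S \<and> p (y\<^sub>0 C) = char_vec C"
    by metis
  define G where "G = {(\<pi>, \<kappa>, \<rho>). \<pi> permutes ?V \<and> \<kappa> permutes {..<n_vars F} \<and> \<rho> permutes {..<n_ineqs F} \<and>
    (\<forall>y\<in>?S. permute_coords \<kappa> y \<in> ?S \<and> p (permute_coords \<kappa> y) = permute_coords (image \<pi>) (p y)) \<and>
    (\<forall>y. \<forall>i<n_ineqs F. slack F (\<rho> i) (permute_coords \<kappa> y) = slack F i y)}"
  have G_ex: "\<exists>\<kappa> \<rho>. (\<pi>, \<kappa>, \<rho>) \<in> G" if \<pi>: "\<pi> permutes ?V" for \<pi>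
  proof -
    have "permute_coords (image \<pi>) \<in> node_actions n" using \<pi> by (auto simp: node_actions_def)
    then obtain \<kappa> \<rho> \<rho>' where \<kappa>: "\<kappa> permutes {..<n_vars F}"
      "\<forall>y\<in>?S. p (permute_coords \<kappa> y) = permute_coords (image \<pi>) (p y)"
      and \<rho>: "\<rho> permutes {..<n_eqs F}" "\<forall>i<n_eqs F. b_eq F (\<rho> i) = b_eq F i \<and> (\<forall>j<n_vars F. A_eq F (\<rho> i) (\<kappa> j) = A_eq F i j)"
      and \<rho>': "\<rho>' permutes {..<n_ineqs F}" "\<forall>i<n_ineqs F. b_le F (\<rho>' i) = b_le F i \<and> (\<forall>j<n_vars F. A_le F (\<rho>' i) (\<kappa> j) = A_le F i j)"
      using sym unfolding symmetric_formulation_def by blast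
    have "permute_coords \<kappa> y \<in> ?S" if "y \<in> ?S" for y
      using permute_solution[OF \<kappa>(1) \<rho> \<rho>' that] .
    moreover have "slack F (\<rho>' i) (permute_coords \<kappa> y) = slack F i y" if "i < n_ineqs F" for i y
      using \<rho>'(2) that by (intro slack_permute[OF \<kappa>(1)]) auto
    ultimately have "(\<pi>, \<kappa>, \<rho>') \<in> G" using \<pi> \<kappa> \<rho>'(1) unfolding G_def by blast
    then show ?thesis by blast
  qed
  have finG: "finite G"
    by (rule finite_subset[of _ "{\<pi>. \<pi> permutes ?V} \<times> {\<kappa>. \<kappa> permutes {..<n_vars F}} \<times> {\<rho>. \<rho> permutes {..<n_ineqs F}}"])
      (auto simp: G_def finite_permutations)
  have "G \<noteq> {}" using G_ex[OF permutes_id] by blast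
  then have w: "(\<Sum>g\<in>G. 1 / card G) = (1 :: real)" using finG by simp
  \<comment> \<open>Pull the cycle back by \<pi>, lift it by the arbitrary choice
    \<open>y\<^sub>0\<close>, and push the lift forward by \<kappa>: another lift of the same
    cycle.\<close>
  define z where "z g C = (case g of (\<pi>, \<kappa>, \<rho>) \<Rightarrow> permute_coords \<kappa> (y\<^sub>0 (image (inv \<pi>) ` C)))" for g :: "(nat \<Rightarrow> nat) \<times> (nat \<Rightarrow> nat) \<times> (nat \<Rightarrow> nat)" and C
  define Y where "Y C = (\<Sum>g\<in>G. (1 / card G) *\<^sub>R z g C)" for C
  have z: "z g C \<in> ?S \<and> p (z g C) = char_vec C" if g: "g \<in> G" and C: "C \<in> cycles l n" for g C
  proof -
    obtain \<pi> \<kappa> \<rho> where eq: "g = (\<pi>, \<kappa>, \<rho>)" by (cases g)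
    have \<pi>: "\<pi> permutes ?V" using g by (simp add: G_def eq)
    have C': "image (inv \<pi>) ` C \<in> cycles l n" using image_cycle[OF C permutes_inv[OF \<pi>]] .
    have "permute_coords (image \<pi>) (char_vec (image (inv \<pi>) ` C)) = char_vec (image \<pi> ` image (inv \<pi>) ` C)"
      using permutes_bij[OF \<pi>] finite_cycle[OF C'] by (rule permute_char_vec)
    also have "image \<pi> ` image (inv \<pi>) ` C = C"
      using permutes_surj[OF \<pi>] by (simp add: image_image surj_f_inv_f)
    finally show ?thesis using g y\<^sub>0[OF C'] by (auto simp: z_def eq G_def)
  qed
  show ?thesis
  proof (rule that[of Y])
    fix C assume C: "C \<in> cycles l n"
    show "Y C \<in> ?S" unfolding Y_def
      using z[OF _ C] by (intro affine_combination_solution w sum_nonneg mult_nonneg_nonneg slack_nonneg) auto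
    have "p (Y C) = (\<Sum>g\<in>G. (1 / card G) *\<^sub>R p (z g C))" unfolding Y_def
      using z[OF _ C] by (intro affine_map_combination[OF aff w]) (auto simp: solutions_def)
    also have "\<dots> = (\<Sum>g\<in>G. (1 / card G) *\<^sub>R char_vec C)"
      using z[OF _ C] by (intro sum.cong) auto
    also have "\<dots> = char_vec C" unfolding scaleR_left.sum[symmetric] w by simp
    finally show "p (Y C) = char_vec C" .
  next
    fix \<pi> assume \<pi>: "\<pi> permutes ?V"
    then obtain \<kappa> \<rho> where g: "(\<pi>, \<kappa>, \<rho>) \<in> G" using G_ex by blast
    then have \<kappa>: "\<kappa> permutes {..<n_vars F}" and \<rho>: "\<rho> permutes {..<n_ineqs F}"
      and sl: "\<And>y i. i < n_ineqs F \<Longrightarrow> slack F (\<rho> i) (permute_coords \<kappa> y) = slack F i y"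
      and act: "\<And>y. y \<in> ?S \<Longrightarrow> permute_coords \<kappa> y \<in> ?S \<and> p (permute_coords \<kappa> y) = permute_coords (image \<pi>) (p y)"
      by (auto simp: G_def)
    \<comment> \<open>Left translation by one triple over \<pi> is injective on the finite set
      \<open>G\<close>, hence permutes it; reindexing the average by it turns the lift of
      \<open>C\<close> into that of its image under \<pi>.\<close>
    define T where "T = (\<lambda>(\<pi>' :: nat \<Rightarrow> nat, \<kappa>' :: nat \<Rightarrow> nat, \<rho>' :: nat \<Rightarrow> nat). (\<pi> \<circ> \<pi>', \<kappa> \<circ> \<kappa>', \<rho> \<circ> \<rho>'))"
    have T_G: "T ` G \<subseteq> G"
    proof
      fix h assume "h \<in> T ` G"
      then obtain g where g: "h = T g" "g \<in> G" by (rule imageE)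
      obtain \<pi>' \<kappa>' \<rho>' where eq: "g = (\<pi>', \<kappa>', \<rho>')" by (cases g)
      have h: "h = (\<pi> \<circ> \<pi>', \<kappa> \<circ> \<kappa>', \<rho> \<circ> \<rho>')" and h': "(\<pi>', \<kappa>', \<rho>') \<in> G"
        using g by (simp_all add: T_def eq)
      then have p': "\<pi>' permutes ?V" "\<kappa>' permutes {..<n_vars F}" "\<rho>' permutes {..<n_ineqs F}"
        and sl': "\<And>y i. i < n_ineqs F \<Longrightarrow> slack F (\<rho>' i) (permute_coords \<kappa>' y) = slack F i y"
        and act': "\<And>y. y \<in> ?S \<Longrightarrow> permute_coords \<kappa>' y \<in> ?S \<and> p (permute_coords \<kappa>' y) = permute_coords (image \<pi>') (p y)"
        by (auto simp: G_def)
      have comp: "permute_coords (\<kappa> \<circ> \<kappa>') y = permute_coords \<kappa> (permute_coords \<kappa>' y)" for y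
        using permute_coords_comp permutes_bij \<kappa> p'(2) by blast
      have comp': "permute_coords (image (\<pi> \<circ> \<pi>')) x = permute_coords (image \<pi>) (permute_coords (image \<pi>') x)" for x :: "nat set \<Rightarrow>\<^sub>0 real"
      proof -
        have "image (\<pi> \<circ> \<pi>') = image \<pi> \<circ> image \<pi>'" by (auto simp: fun_eq_iff)
        then show ?thesis
          using permute_coords_comp[of "image \<pi>" "image \<pi>'" x] bij_image(1) permutes_bij \<pi> p'(1) by metis
      qed
      have "\<rho>' i < n_ineqs F" if "i < n_ineqs F" for i
        using permutes_in_image[OF p'(3), of i] that by simp
      then have "slack F ((\<rho> \<circ> \<rho>') i) (permute_coords (\<kappa> \<circ> \<kappa>') y) = slack F i y" if "i < n_ineqs F" for i y
        using that by (simp add: comp sl sl')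
      moreover have "permute_coords (\<kappa> \<circ> \<kappa>') y \<in> ?S \<and>
          p (permute_coords (\<kappa> \<circ> \<kappa>') y) = permute_coords (image (\<pi> \<circ> \<pi>')) (p y)" if "y \<in> ?S" for y
        using act act' that unfolding comp comp' by metis
      ultimately show "h \<in> G"
        unfolding h G_def using permutes_compose \<pi> \<kappa> \<rho> p' by blast
    qed
    have inj: "inj_on T G"
    proof (rule inj_onI)
      have cancel: "f = f'" if "q \<circ> f = q \<circ> f'" "inj q" for q f f' :: "nat \<Rightarrow> nat"
        using fun_cong[OF that(1)] that(2) by (auto dest: injD)
      fix x y assume "T x = T y"
      moreover obtain \<pi>1 \<kappa>1 \<rho>1 where x: "x = (\<pi>1, \<kappa>1, \<rho>1)" by (cases x)
      moreover obtain \<pi>2 \<kappa>2 \<rho>2 where y: "y = (\<pi>2, \<kappa>2, \<rho>2)" by (cases y)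
      ultimately have "\<pi> \<circ> \<pi>1 = \<pi> \<circ> \<pi>2" "\<kappa> \<circ> \<kappa>1 = \<kappa> \<circ> \<kappa>2" "\<rho> \<circ> \<rho>1 = \<rho> \<circ> \<rho>2"
        by (simp_all add: T_def)
      then show "x = y"
        unfolding x y
        using cancel permutes_inj[OF \<pi>] permutes_inj[OF \<kappa>] permutes_inj[OF \<rho>] by blast
    qed
    then have TG: "T ` G = G" using T_G finG by (simp add: endo_inj_surj)
    have "slack F (\<rho> i) (Y (image \<pi> ` C)) = slack F i (Y C)" if C: "C \<in> cycles l n" and i: "i < n_ineqs F" for C i
    proof -
      have zT: "z (T g) (image \<pi> ` C) = permute_coords \<kappa> (z g C)" if "g \<in> G" for g
      proof -
        obtain \<pi>' \<kappa>' \<rho>' where eq: "g = (\<pi>', \<kappa>', \<rho>')" by (cases g)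
        have p': "\<pi>' permutes ?V" "\<kappa>' permutes {..<n_vars F}" using that by (auto simp: G_def eq)
        have "image (inv (\<pi> \<circ> \<pi>')) ` image \<pi> ` C = image (inv \<pi>') ` C"
          using permutes_bij[OF \<pi>] permutes_bij[OF p'(1)]
          by (simp add: o_inv_distrib image_image bij_is_inj bij_is_surj)
        then show ?thesis
          using permute_coords_comp[OF permutes_bij[OF \<kappa>] permutes_bij[OF p'(2)]] by (simp add: z_def T_def eq)
      qed
      have "slack F (\<rho> i) (Y (image \<pi> ` C)) = (\<Sum>g\<in>G. 1 / card G * slack F (\<rho> i) (z g (image \<pi> ` C)))"
        unfolding Y_def by (rule slack_affine[OF w])
      also have "\<dots> = (\<Sum>g\<in>G. 1 / card G * slack F (\<rho> i) (z (T g) (image \<pi> ` C)))"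
        using sum.reindex[OF inj, of "\<lambda>g. 1 / card G * slack F (\<rho> i) (z g (image \<pi> ` C))"]
        by (simp only: TG o_def)
      also have "\<dots> = (\<Sum>g\<in>G. 1 / card G * slack F i (z g C))"
        using i by (intro sum.cong refl) (simp add: zT sl)
      also have "\<dots> = slack F i (Y C)"
        unfolding Y_def by (rule slack_affine[OF w, symmetric])
      finally show ?thesis .
    qed
    then show "\<exists>\<rho>. \<rho> permutes {..<n_ineqs F} \<and>
        (\<forall>C\<in>cycles l n. \<forall>i<n_ineqs F. slack F (\<rho> i) (Y (image \<pi> ` C)) = slack F i (Y C))"
      using \<rho> by blast
  qed
qed

section \<open>The lower bound\<close>

lemma blossom_affine:
  assumes "(\<Sum>x\<in>X. w x) = 1"
  shows "blossom a n (\<Sum>x\<in>X. w x *\<^sub>R Y x) = (\<Sum>x\<in>X. w x * blossom a n (Y x))"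
proof -
  have 1: "(\<Sum>e\<in>E. \<Sum>x\<in>X. w x * f x e) = (\<Sum>x\<in>X. w x * (\<Sum>e\<in>E. f x e))" for f and E :: "'z set"
    unfolding sum_distrib_left by (rule sum.swap)
  have 2: "1 - (\<Sum>x\<in>X. w x * f x) = (\<Sum>x\<in>X. w x * (1 - f x))" for f
    using assms by (simp add: right_diff_distrib sum_subtractf)
  show ?thesis
    by (simp only: blossom_def lookup_sum lookup_scaleR 2 1 sum.distrib[symmetric] distrib_left)
qed

lemma blossom_cycle_polytope:
  assumes "x \<in> cycle_polytope l n" "odd a"
  shows "1 \<le> blossom a n x"
proof -
  let ?X = "char_vec ` cycles l n"
  have "finite ?X" using finite_cycles by simp
  then obtain u where u: "\<forall>v\<in>?X. 0 \<le> u v" "sum u ?X = 1" "(\<Sum>v\<in>?X. u v *\<^sub>R v) = x"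
    using assms(1) by (auto simp: cycle_polytope_def convex_hull_finite)
  have "1 = (\<Sum>v\<in>?X. u v * 1)" using u(2) by simp
  also have "\<dots> \<le> (\<Sum>v\<in>?X. u v * blossom a n v)"
    using u(1) blossom_ge_1[OF _ assms(2)] by (intro sum_mono mult_left_mono) auto
  also have "\<dots> = blossom a n x" using blossom_affine[OF u(2), of a n "\<lambda>v. v"] u(3) by simp
  finally show ?thesis .
qed

text \<open>A swap of two tokens whose four nodes avoid \<open>W\<close> is (x y)(y z) followed by
  (y z)(z w), a product of two available three-cycles; such swaps generate all the permutations in
  question.\<close>

lemma lift_tokens_mem:
  assumes "bounded_index_subgroup {1..n} U \<phi> D" and N: "2 * N \<le> n"
    and W: "bounded_index_subgroup.all_three_cycles U ({1..n} - W)"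
    and \<tau>: "\<tau> permutes {u. u < N \<and> 2 * u + 1 \<notin> W \<and> 2 * u + 2 \<notin> W}"
  shows "lift_tokens N \<tau> \<in> U"
proof -
  interpret bounded_index_subgroup "{1..n}" U \<phi> D by fact
  let ?V = "{1..n}" and ?N = "{u. u < N \<and> 2 * u + 1 \<notin> W \<and> 2 * u + 2 \<notin> W}"
  have "finite ?N" by simp
  with \<tau> show ?thesis
  proof (induction rule: permutes_induct)
    case id
    show ?case using id_closed by (simp only: lift_tokens_id)
  next
    case (swap u v \<tau>)
    have \<tau>: "\<tau> permutes {..<N}" using swap.hyps(4) by (rule permutes_subset) auto
    have uv: "u < N" "v < N" using swap.hyps by auto
    define x y z w where "x = 2 * u + 1" and "y = 2 * v + 1" and "z = 2 * u + 2" and "w = 2 * v + 2"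
    have mem: "x \<in> ?V - W" "y \<in> ?V - W" "z \<in> ?V - W" "w \<in> ?V - W"
      using swap.hyps(1,2) N by (auto simp: x_def y_def z_def w_def)
    have ne: "x \<noteq> y" "z \<noteq> w" "x \<noteq> z" "y \<noteq> w" using swap.hyps(3) by (auto simp: x_def y_def z_def w_def)
    have "y \<noteq> z" unfolding y_def z_def by presburger
    then have "transpose x y \<circ> transpose y z \<in> U" "transpose y z \<circ> transpose z w \<in> U"
      using W mem ne unfolding all_three_cycles_def by blast+
    then have "transpose x y \<circ> transpose y z \<circ> (transpose y z \<circ> transpose z w) \<in> U"
      by (rule comp_closed)
    then have "lift_tokens N (transpose u v) \<in> U"
      using lift_tokens_transpose[OF uv] by (simp only: transpose_cancel x_def y_def z_def w_def)
    then show ?case using comp_closed swap.IH by (simp only: lift_tokens_comp[OF \<tau>])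
  qed
qed

text \<open>Fewer inequalities would give every slack function a stabiliser of index below
  \<open>t choose (k + 1)\<close>, so that along the token arrangements it would depend on the
  positions of at most \<open>k\<close> tokens, and \<mu> could not tell the infeasible combination
  from a solution.\<close>

theorem symmetric_formulation_size:
  assumes ext: "extended_formulation (complete_edges n) (cycle_polytope l n) F p"
    and sym: "symmetric_formulation (node_actions n) F p"
    and k: "1 \<le> k" and l: "8 * k + 4 \<le> l" "l \<le> n"
    and t: "3 * k + 3 \<le> t" "t * (k + 3) \<le> n"
  shows "t choose (k + 1) \<le> n_ineqs F"
proof (rule ccontr)
  assume small: "\<not> ?thesis"
  obtain Y where Y: "\<And>C. C \<in> cycles l n \<Longrightarrow> Y C \<in> solutions F"
    "\<And>C. C \<in> cycles l n \<Longrightarrow> p (Y C) = char_vec C"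
    and equi: "\<And>\<pi>. \<pi> permutes {1..n} \<Longrightarrow> \<exists>\<rho>. \<rho> permutes {..<n_ineqs F} \<and>
      (\<forall>C\<in>cycles l n. \<forall>i<n_ineqs F. slack F (\<rho> i) (Y (image \<pi> ` C)) = slack F i (Y C))"
    using equivariant_lift[OF ext sym] by metis
  \<comment> \<open>With \<open>a = m\<close> the requirements \<open>2 * k + 1 \<le> a\<close> and
    \<open>a + 2 * k + 1 \<le> 2 * m\<close> both become equalities, and \<open>m\<close> is odd;
    the \<open>2 * m\<close> tokens then occupy \<open>4 * m = 8 * k + 4\<close> cycle
    nodes.\<close>
  define m where "m = 2 * k + 1"
  have lm: "3 \<le> l" "4 * m \<le> l" using l by (simp_all add: m_def)
  have nm: "2 * (2 * m) \<le> n" using lm l by simp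
  interpret blocks m m by unfold_locales simp
  define L where "L = lift_tokens (2 * m)"
  have L: "L \<sigma> permutes {1..n}" if "\<sigma> permutes {..<2 * m}" for \<sigma>
    using lift_tokens_permutes[OF that nm] by (simp add: L_def)
  define c where "c \<sigma> = image (L \<sigma>) ` ref_cycle m l" for \<sigma>
  have ref: "ref_cycle m l \<in> cycles l n" using ref_cycle_in_cycles lm l by blast
  have c: "c \<sigma> \<in> cycles l n" if "\<sigma> permutes {..<2 * m}" for \<sigma>
    unfolding c_def using image_cycle[OF ref L[OF that]] .
  have odd: "odd m" by (simp add: m_def)
  obtain \<mu> :: "(nat \<Rightarrow> nat) \<Rightarrow> real" where \<mu>: "(\<Sum>\<sigma> | \<sigma> permutes {..<2 * m}. \<mu> \<sigma>) = 1"
    "(\<Sum>\<sigma> | \<sigma> permutes {..<2 * m}. \<mu> \<sigma> * splits \<sigma>) = 0"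
    and \<mu>_pos: "\<And>s W. W \<subseteq> {..<2 * m} \<Longrightarrow> card W \<le> k \<Longrightarrow> (\<And>\<sigma>. \<sigma> permutes {..<2 * m} \<Longrightarrow> 0 \<le> s \<sigma>) \<Longrightarrow>
      (\<And>\<tau> \<sigma>. \<tau> permutes {..<2 * m} \<Longrightarrow> \<sigma> permutes {..<2 * m} \<Longrightarrow> \<forall>w\<in>W. \<tau> w = w \<Longrightarrow> s (\<tau> \<circ> \<sigma>) = s \<sigma>) \<Longrightarrow>
      0 \<le> (\<Sum>\<sigma> | \<sigma> permutes {..<2 * m}. \<mu> \<sigma> * s \<sigma>)"
    by (rule pseudo_distribution[OF odd _ _ k]) (simp_all add: m_def)
  have pos: "0 \<le> (\<Sum>\<sigma> | \<sigma> permutes {..<2 * m}. \<mu> \<sigma> * slack F i (Y (c \<sigma>)))" if i: "i < n_ineqs F" for i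
  proof -
    \<comment> \<open>The stabiliser of the \<open>i\<close>-th slack function, regarded as a
      function on lifted cycles. Restricting \<open>\<phi>\<close> to \<open>cycles l n\<close>
      makes its values comparable as functions.\<close>
    define U where "U = {\<pi>. \<pi> permutes {1..n} \<and> (\<forall>C\<in>cycles l n. slack F i (Y (image \<pi> ` C)) = slack F i (Y C))}"
    define \<phi> where "\<phi> \<pi> = restrict (\<lambda>C. slack F i (Y (image \<pi> ` C))) (cycles l n)" for \<pi>
    have img_inv: "image \<pi> ` image (inv \<pi>) ` C = C" "image (inv \<pi>) ` image \<pi> ` C = C"
      if "\<pi> permutes {1..n}" for \<pi> and C :: "nat set set"
      using permutes_inverses[OF that] by (simp_all add: image_image)
    interpret small_index_subgroup "{1..n}" U \<phi> "n_ineqs F" k t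
    proof
      show "u permutes {1..n}" if "u \<in> U" for u using that by (simp add: U_def)
      show "u \<circ> v \<in> U" if "u \<in> U" "v \<in> U" for u v
      proof -
        have "image (u \<circ> v) ` C = image u ` image v ` C" for C :: "nat set set" by (simp add: image_image)
        then show ?thesis using that image_cycle by (simp add: U_def permutes_compose)
      qed
      show "inv u \<in> U" if "u \<in> U" for u
      proof -
        have u: "u permutes {1..n}" "\<And>C. C \<in> cycles l n \<Longrightarrow> slack F i (Y (image u ` C)) = slack F i (Y C)"
          using that by (auto simp: U_def)
        have "slack F i (Y (image (inv u) ` C)) = slack F i (Y C)" if "C \<in> cycles l n" for C
          using u(2)[OF image_cycle[OF that permutes_inv[OF u(1)]]] by (simp only: img_inv[OF u(1)])
        then show ?thesis using permutes_inv[OF u(1)] by (simp add: U_def)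
      qed
      show "\<pi> \<circ> inv \<pi>' \<in> U" if \<pi>: "\<pi> permutes {1..n}" "\<pi>' permutes {1..n}" and eq: "\<phi> \<pi> = \<phi> \<pi>'" for \<pi> \<pi>'
      proof -
        have "slack F i (Y (image (\<pi> \<circ> inv \<pi>') ` C)) = slack F i (Y C)" if "C \<in> cycles l n" for C
        proof -
          let ?C = "image (inv \<pi>') ` C"
          have "?C \<in> cycles l n" using image_cycle[OF that permutes_inv[OF \<pi>(2)]] .
          then have "slack F i (Y (image \<pi> ` ?C)) = slack F i (Y (image \<pi>' ` ?C))"
            using fun_cong[OF eq, of ?C] by (simp only: \<phi>_def restrict_apply if_True)
          moreover have "image (\<pi> \<circ> inv \<pi>') ` C = image \<pi> ` ?C" by (simp add: image_image)
          ultimately show ?thesis by (simp only: img_inv[OF \<pi>(2)])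
        qed
        moreover have "\<pi> \<circ> inv \<pi>' permutes {1..n}"
          using permutes_compose[OF permutes_inv[OF \<pi>(2)] \<pi>(1)] .
        ultimately show ?thesis unfolding U_def by blast
      qed
      \<comment> \<open>The index is the size of an orbit, and equivariance keeps this orbit inside
        the finite list of slack functions.\<close>
      have "\<phi> ` {\<pi>. \<pi> permutes {1..n}} \<subseteq> (\<lambda>i. restrict (\<lambda>C. slack F i (Y C)) (cycles l n)) ` {..<n_ineqs F}"
      proof
        fix f assume "f \<in> \<phi> ` {\<pi>. \<pi> permutes {1..n}}"
        then obtain \<pi> where \<pi>: "\<pi> permutes {1..n}" "f = \<phi> \<pi>" by blast
        obtain \<rho> where \<rho>: "\<rho> permutes {..<n_ineqs F}"
          "\<And>C i. C \<in> cycles l n \<Longrightarrow> i < n_ineqs F \<Longrightarrow> slack F (\<rho> i) (Y (image \<pi> ` C)) = slack F i (Y C)"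
          using equi[OF \<pi>(1)] by blast
        have i': "inv \<rho> i < n_ineqs F" using permutes_in_image[OF permutes_inv[OF \<rho>(1)], of i] i by simp
        have "slack F i (Y (image \<pi> ` C)) = slack F (inv \<rho> i) (Y C)" if "C \<in> cycles l n" for C
          using \<rho>(2)[OF that i'] by (simp only: permutes_inverses[OF \<rho>(1)])
        then have "f = restrict (\<lambda>C. slack F (inv \<rho> i) (Y C)) (cycles l n)"
          by (auto simp: \<pi>(2) \<phi>_def)
        then show "f \<in> (\<lambda>i. restrict (\<lambda>C. slack F i (Y C)) (cycles l n)) ` {..<n_ineqs F}"
          using i' by blast
      qed
      then have "card (\<phi> ` {\<pi>. \<pi> permutes {1..n}}) \<le> card ((\<lambda>i. restrict (\<lambda>C. slack F i (Y C)) (cycles l n)) ` {..<n_ineqs F})"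
        by (intro card_mono) auto
      also have "\<dots> \<le> n_ineqs F" using card_image_le[of "{..<n_ineqs F}"] by fastforce
      finally show "card (\<phi> ` {\<pi>. \<pi> permutes {1..n}}) \<le> n_ineqs F" .
    qed (use t small in auto)
    obtain W where W: "W \<subseteq> {1..n}" "card W \<le> k" "all_three_cycles ({1..n} - W)"
      by (rule contains_three_cycles)
    \<comment> \<open>A token is given up if either of its nodes lies in \<open>W\<close>; each node
      belongs to at most one token, so at most \<open>k\<close> tokens are lost.\<close>
    define W' where "W' = {u. u < 2 * m \<and> (2 * u + 1 \<in> W \<or> 2 * u + 2 \<in> W)}"
    have finW: "finite W" using W(1) finite_subset by blast
    show ?thesis
    proof (rule \<mu>_pos[of W'])
      show "W' \<subseteq> {..<2 * m}" by (auto simp: W'_def)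
      have "W' \<subseteq> (\<lambda>x. (x - 1) div 2) ` W"
        by (force simp: W'_def)
      then have "card W' \<le> card W" using finW by (meson card_image_le card_mono finite_imageI order.trans)
      then show "card W' \<le> k" using W(2) by simp
      show "0 \<le> slack F i (Y (c \<sigma>))" if "\<sigma> permutes {..<2 * m}" for \<sigma>
        using Y(1)[OF c[OF that]] i by (rule slack_nonneg)
      fix \<tau> \<sigma> assume \<tau>: "\<tau> permutes {..<2 * m}" and \<sigma>: "\<sigma> permutes {..<2 * m}" and fixed: "\<forall>w\<in>W'. \<tau> w = w"
      have "\<tau> permutes {u. u < 2 * m \<and> 2 * u + 1 \<notin> W \<and> 2 * u + 2 \<notin> W}"
        using \<tau> by (rule permutes_superset) (use fixed in \<open>auto simp: W'_def\<close>)
      then have "L \<tau> \<in> U" unfolding L_def using lift_tokens_mem[OF bounded_index_subgroup_axioms nm W(3)] by blast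
      moreover have "c (\<tau> \<circ> \<sigma>) = image (L \<tau>) ` c \<sigma>"
        unfolding c_def L_def lift_tokens_comp[OF \<sigma>] by (simp add: image_image)
      ultimately show "slack F i (Y (c (\<tau> \<circ> \<sigma>))) = slack F i (Y (c \<sigma>))"
        using c[OF \<sigma>] by (simp add: U_def)
    qed
  qed
  let ?P = "{\<sigma>. \<sigma> permutes {..<2 * m}}"
  \<comment> \<open>The slacks of this signed combination are nonnegative, so it is a solution; yet
    the blossom functional of its projection is the \<mu>-average of \<open>splits\<close>, which is
    0.\<close>
  define y where "y = (\<Sum>\<sigma>\<in>?P. \<mu> \<sigma> *\<^sub>R Y (c \<sigma>))"
  have "y \<in> solutions F"
    unfolding y_def using \<mu>(1) Y(1) c pos by (intro affine_combination_solution) auto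
  then have "p y \<in> cycle_polytope l n" using ext by (auto simp: extended_formulation_def)
  then have "1 \<le> blossom m n (p y)" using odd by (rule blossom_cycle_polytope)
  also have "p y = (\<Sum>\<sigma>\<in>?P. \<mu> \<sigma> *\<^sub>R p (Y (c \<sigma>)))"
    unfolding y_def using ext \<mu>(1) Y(1) c
    by (intro affine_map_combination[where J = "{..<n_vars F}" and I = "complete_edges n"])
      (auto simp: extended_formulation_def solutions_def)
  also have "blossom m n \<dots> = (\<Sum>\<sigma>\<in>?P. \<mu> \<sigma> * blossom m n (p (Y (c \<sigma>))))"
    using \<mu>(1) by (rule blossom_affine)
  also have "\<dots> = (\<Sum>\<sigma>\<in>?P. \<mu> \<sigma> * splits \<sigma>)"
  proof (intro sum.cong refl)
    fix \<sigma> assume "\<sigma> \<in> ?P"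
    then show "\<mu> \<sigma> * blossom m n (p (Y (c \<sigma>))) = \<mu> \<sigma> * splits \<sigma>"
      using Y(2)[OF c] blossom_ref_cycle[of \<sigma> m m l n] lm l(2) by (simp add: c_def L_def)
  qed
  finally show False using \<mu>(2) by simp
qed

section \<open>Polynomial bounds against binomial growth\<close>

lemma real_polynomial_function_growth:
  assumes "real_polynomial_function q"
  obtains c :: real and K :: nat where "\<And>x r. 1 \<le> r \<Longrightarrow> norm x \<le> r \<Longrightarrow> \<bar>q x\<bar> \<le> c * r ^ K"
proof -
  \<comment> \<open>The bound is stated for any \<open>r \<ge> 1\<close> above the norm: powers of
    \<open>r\<close> then increase with the exponent, so sums and products of bounds have the same
    form.\<close>
  have "\<exists>c K. \<forall>x r. 1 \<le> r \<longrightarrow> norm x \<le> r \<longrightarrow> \<bar>q x\<bar> \<le> c * r ^ K"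
    using assms
  proof induction
    case (linear f)
    then obtain B where B: "\<And>x. norm (f x) \<le> norm x * B" "0 < B"
      using bounded_linear.pos_bounded by blast
    have "\<bar>f x\<bar> \<le> B * r ^ 1" if "norm x \<le> r" for x r
    proof -
      have "\<bar>f x\<bar> \<le> norm x * B" using B(1)[of x] by simp
      also have "\<dots> \<le> r * B" using that B(2) by simp
      finally show ?thesis by (simp add: mult.commute)
    qed
    then show ?case by blast
  next
    case (const c)
    have "\<bar>c\<bar> \<le> \<bar>c\<bar> * r ^ 0" for r :: real by simp
    then show ?case by blast
  next
    case (add f g)
    then obtain c K c' K' where
      f: "\<And>x r. 1 \<le> r \<Longrightarrow> norm x \<le> r \<Longrightarrow> \<bar>f x\<bar> \<le> c * r ^ K" and
      g: "\<And>x r. 1 \<le> r \<Longrightarrow> norm x \<le> r \<Longrightarrow> \<bar>g x\<bar> \<le> c' * r ^ K'" by blast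
    have "\<bar>f x + g x\<bar> \<le> (\<bar>c\<bar> + \<bar>c'\<bar>) * r ^ (K + K')" if "1 \<le> r" "norm x \<le> r" for x r
    proof -
      have "\<bar>f x + g x\<bar> \<le> c * r ^ K + c' * r ^ K'" using f[OF that] g[OF that] by linarith
      also have "\<dots> \<le> \<bar>c\<bar> * r ^ (K + K') + \<bar>c'\<bar> * r ^ (K + K')"
        using that by (intro add_mono mult_mono power_increasing) auto
      finally show ?thesis by (simp add: algebra_simps)
    qed
    then show ?case by blast
  next
    case (mult f g)
    then obtain c K c' K' where
      f: "\<And>x r. 1 \<le> r \<Longrightarrow> norm x \<le> r \<Longrightarrow> \<bar>f x\<bar> \<le> c * r ^ K" and
      g: "\<And>x r. 1 \<le> r \<Longrightarrow> norm x \<le> r \<Longrightarrow> \<bar>g x\<bar> \<le> c' * r ^ K'" by blast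
    have "\<bar>f x * g x\<bar> \<le> (c * c') * r ^ (K + K')" if "1 \<le> r" "norm x \<le> r" for x r
    proof -
      have "\<bar>f x * g x\<bar> \<le> (c * r ^ K) * (c' * r ^ K')"
        unfolding abs_mult using f[OF that] g[OF that] by (intro mult_mono) auto
      then show ?thesis by (simp add: power_add mult_ac)
    qed
    then show ?case by blast
  qed
  then show ?thesis using that by blast
qed

lemma extreme_point_of_convex_hull_mem:
  assumes "x extreme_point_of (convex hull S)"
  shows "x \<in> S"
proof (rule ccontr)
  assume "x \<notin> S"
  have "convex (convex hull S - {x})"
    using assms extreme_point_of_stillconvex[OF convex_convex_hull] by blast
  moreover have "S \<subseteq> convex hull S - {x}" using \<open>x \<notin> S\<close> hull_subset by fastforce
  ultimately have "convex hull S \<subseteq> convex hull S - {x}" by (rule hull_minimal[rotated])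
  then show False using assms by (auto simp: extreme_point_of_def)
qed

text \<open>Vertices are 0/1 vectors, and the fractions 0/1 and 1/1 have encoding lengths 3 and 4.
  If there are no values, the supremum is 0.\<close>

lemma max_vertex_enc_length_cycle_polytope:
  "max_vertex_enc_length I (cycle_polytope l n) \<le> 4"
proof -
  let ?A = "{enc_length r | r x i. x extreme_point_of cycle_polytope l n \<and> i \<in> I \<and> Poly_Mapping.lookup x i = of_rat r}"
  have "e \<le> 4" if e: "e \<in> ?A" for e
  proof -
    obtain r x i where r: "e = enc_length r" "x extreme_point_of cycle_polytope l n" "Poly_Mapping.lookup x i = of_rat r"
      using e by blast
    then obtain C where "C \<in> cycles l n" "x = char_vec C"
      unfolding cycle_polytope_def using extreme_point_of_convex_hull_mem by blast
    then have "of_rat r = (of_bool (i \<in> C) :: real)" using r(3) by (simp add: lookup_char_vec finite_cycle)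
    then have "r = 0 \<or> r = 1" by (cases "i \<in> C") auto
    then show ?thesis
      using r(1) by (auto simp: enc_length_def int_enc_length_def bitlen_def floorlog_def)
  qed
  moreover have "Sup X \<le> 4" if "\<And>e. e \<in> X \<Longrightarrow> e \<le> 4" for X :: "nat set"
    using that cSup_least[of X 4] by (cases "X = {}") (auto simp: Sup_nat_def)
  ultimately show ?thesis unfolding max_vertex_enc_length_def by blast
qed

lemma card_complete_edges_le: "card (complete_edges n) \<le> n ^ 2"
proof -
  have "card (complete_edges n) = n choose 2"
    unfolding complete_edges_def using n_subsets[of "{1..n}" 2] by simp
  also have "\<dots> \<le> n ^ 2" by (cases "2 \<le> n") (simp_all add: binomial_le_pow binomial_eq_0)
  finally show ?thesis .
qed

text \<open>The binomial coefficient is at least the power (n / A) ^ (k + 1) with A = 2 (k + 3)(k +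
  1). Of the two powers of \<open>n\<close> by which this exceeds n ^ (k - 1), one absorbs the
  constant c A ^ (k + 1).\<close>

lemma power_less_choose:
  fixes c :: real
  assumes "(k + 3) * (k + 1) \<le> n" "1 \<le> k" "0 \<le> c" "c * (2 * (real k + 3) * (real k + 1)) ^ (k + 1) < real n"
  shows "c * real n ^ (k - 1) < (n div (k + 3)) choose (k + 1)"
proof -
  let ?t = "n div (k + 3)"
  define A where "A = 2 * (real k + 3) * (real k + 1)"
  have tk: "k + 1 \<le> ?t" using assms(1) by (simp add: less_eq_div_iff_mult_less_eq mult.commute)
  have n0: "real n \<ge> 1" using assms(1) by (simp add: le_trans)
  have A: "A > 0" by (simp add: A_def add_pos_pos)
  have "n < (?t + 1) * (k + 3)" using dividend_less_div_times[of "k + 3" n] by (simp add: algebra_simps)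
  \<comment> \<open>The factor 2 in \<open>A\<close> pays for rounding down in
    \<open>n div (k + 3)\<close>.\<close>
  also have "\<dots> \<le> (2 * ?t) * (k + 3)" using tk by (intro mult_right_mono) auto
  finally have "real n \<le> 2 * ?t * (real k + 3)" by (metis (mono_tags) less_imp_le of_nat_le_iff of_nat_mult of_nat_add of_nat_numeral)
  then have "real n / A \<le> 2 * real ?t * (real k + 3) / A" using A by (intro divide_right_mono) auto
  also have "2 * real ?t * (real k + 3) / A = real ?t / real (k + 1)"
  proof -
    have "2 * s * x / (2 * x * y) = s / y" if "x \<noteq> 0" for s x y :: real using that by simp
    from this[of "real k + 3" "real ?t" "real k + 1"] show ?thesis by (simp add: A_def add.commute)
  qed
  finally have frac: "real n / A \<le> real ?t / real (k + 1)" .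
  have "c * real n ^ (k - 1) * A ^ (k + 1) = c * A ^ (k + 1) * real n ^ (k - 1)" by (simp only: mult_ac)
  also have "\<dots> < real n * real n ^ (k - 1)"
    using assms(4) n0 by (intro mult_strict_right_mono) (simp_all only: A_def, simp)
  also have "\<dots> \<le> real n * real n * real n ^ (k - 1)"
    using n0 mult_right_mono[of 1 "real n" "real n * real n ^ (k - 1)"] by (simp add: mult_ac)
  also have "\<dots> = real n ^ (k + 1)"
    using assms(2) by (cases k) (simp_all add: mult_ac)
  finally have "c * real n ^ (k - 1) < (real n / A) ^ (k + 1)"
    by (simp only: power_divide pos_less_divide_eq[OF zero_less_power[OF A]])
  also have "\<dots> \<le> (real ?t / real (k + 1)) ^ (k + 1)"
    using frac A by (intro power_mono) auto
  also have "\<dots> \<le> real (?t choose (k + 1))"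
    using binomial_ge_n_over_k_pow_k[OF tk, where ?'a = real] by simp
  finally show ?thesis .
qed

theorem corollary27:
  fixes l :: "nat \<Rightarrow> nat" and c :: real and n\<^sub>0 :: nat
  assumes "c > 0"
    and "\<And>n. n \<ge> n\<^sub>0 \<Longrightarrow> c * ln (real n) \<le> real (l n) \<and> l n \<le> n"
  shows "\<not> (\<exists>(F :: nat \<Rightarrow> lin_system) (p :: nat \<Rightarrow> (nat \<Rightarrow>\<^sub>0 real) \<Rightarrow> (nat set \<Rightarrow>\<^sub>0 real)).
            (\<forall>n\<ge>n\<^sub>0. extended_formulation (complete_edges n) (cycle_polytope (l n) n) (F n) (p n) \<and>
                      symmetric_formulation (node_actions n) (F n) (p n)) \<and>
            compact_family {n\<^sub>0..} complete_edges (\<lambda>n. cycle_polytope (l n) n) F)"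
proof
  assume "\<exists>(F :: nat \<Rightarrow> lin_system) (p :: nat \<Rightarrow> (nat \<Rightarrow>\<^sub>0 real) \<Rightarrow> (nat set \<Rightarrow>\<^sub>0 real)).
            (\<forall>n\<ge>n\<^sub>0. extended_formulation (complete_edges n) (cycle_polytope (l n) n) (F n) (p n) \<and>
                      symmetric_formulation (node_actions n) (F n) (p n)) \<and>
            compact_family {n\<^sub>0..} complete_edges (\<lambda>n. cycle_polytope (l n) n) F"
  then obtain F :: "nat \<Rightarrow> lin_system" and p :: "nat \<Rightarrow> (nat \<Rightarrow>\<^sub>0 real) \<Rightarrow> (nat set \<Rightarrow>\<^sub>0 real)" where
    F: "\<And>n. n \<ge> n\<^sub>0 \<Longrightarrow> extended_formulation (complete_edges n) (cycle_polytope (l n) n) (F n) (p n)"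
       "\<And>n. n \<ge> n\<^sub>0 \<Longrightarrow> symmetric_formulation (node_actions n) (F n) (p n)"
    and compact: "compact_family {n\<^sub>0..} complete_edges (\<lambda>n. cycle_polytope (l n) n) F"
    by blast
  from compact obtain q :: "real \<times> real \<Rightarrow> real" where q: "real_polynomial_function q"
    and size: "\<And>n. n \<ge> n\<^sub>0 \<Longrightarrow> real (n_ineqs (F n)) \<le>
      q (real (card (complete_edges n)), real (max_vertex_enc_length (complete_edges n) (cycle_polytope (l n) n)))"
    unfolding compact_family_def Let_def by auto
  obtain b :: real and K where bK: "\<And>x r. 1 \<le> r \<Longrightarrow> norm x \<le> r \<Longrightarrow> \<bar>q x\<bar> \<le> b * r ^ K"
    using real_polynomial_function_growth[OF q] by metis
  \<comment> \<open>The argument of \<open>q\<close> will have norm at most n ^ 3, so the size is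
    bounded by a constant times n ^ (3 * K), that is n ^ (k - 1), the exponent that
    \<open>power_less_choose\<close> beats.\<close>
  define k where "k = 3 * K + 1"
  define M where "M = max b 0 * (2 * (real k + 3) * (real k + 1)) ^ (k + 1)"
  \<comment> \<open>One summand per threshold: the range of the family, the size of
    \<open>?t\<close>, the constant in \<open>power_less_choose\<close>, a logarithm large enough
    for cycles of length \<open>8 * k + 4\<close>, and \<open>2 \<le> n\<close> for n ^ 2 + 4 \<le>
    n ^ 3.\<close>
  obtain n where n: "real n > real n\<^sub>0 + real ((k + 3) * (3 * k + 3)) + M + exp ((8 * k + 4) / c) + 2"
    using reals_Archimedean2 by blast
  have "M \<ge> 0" by (simp add: M_def)
  then have "real n\<^sub>0 \<le> real n" "real ((k + 3) * (3 * k + 3)) \<le> real n" "M < real n"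
    "exp ((8 * k + 4) / c) \<le> real n" "2 \<le> real n"
    using n exp_gt_zero[of "(8 * k + 4) / c"] by linarith+
  then have n': "n\<^sub>0 \<le> n" "(k + 3) * (3 * k + 3) \<le> n" "M < real n" "exp ((8 * k + 4) / c) \<le> real n" "2 \<le> n"
    by (simp_all only: of_nat_le_iff)
  have "(8 * k + 4) / c \<le> ln (real n)" using n'(4,5) by (subst ln_ge_iff) auto
  then have "real (8 * k + 4) \<le> c * ln (real n)" using assms(1) by (simp add: field_simps)
  then have "real (8 * k + 4) \<le> real (l n)" using assms(2)[OF n'(1)] by linarith
  then have l: "8 * k + 4 \<le> l n" "l n \<le> n" using assms(2)[OF n'(1)] by simp_all
  \<comment> \<open>The largest auxiliary size that \<open>t * (k + 3) \<le> n\<close>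
    allows.\<close>
  let ?t = "n div (k + 3)"
  have t: "3 * k + 3 \<le> ?t" "?t * (k + 3) \<le> n"
    using n'(2) by (simp_all add: less_eq_div_iff_mult_less_eq mult.commute)
  let ?x = "(real (card (complete_edges n)), real (max_vertex_enc_length (complete_edges n) (cycle_polytope (l n) n)))"
  have "norm ?x \<le> real (card (complete_edges n)) + real (max_vertex_enc_length (complete_edges n) (cycle_polytope (l n) n))"
    using norm_Pair_le[of "real (card (complete_edges n))"] by (metis norm_of_nat)
  also have "\<dots> \<le> real (n ^ 2) + real 4"
    using card_complete_edges_le max_vertex_enc_length_cycle_polytope by (intro add_mono of_nat_mono)
  also have "\<dots> \<le> real n ^ 3"
  proof -
    have "n ^ 2 + 4 \<le> n ^ 2 * 2" using power_mono[OF n'(5), of 2] by simp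
    also have "\<dots> \<le> n ^ 2 * n" using n'(5) by (intro mult_left_mono) auto
    also have "\<dots> = n ^ 3" by (simp add: power2_eq_square power3_eq_cube)
    finally have "real (n ^ 2 + 4) \<le> real (n ^ 3)" by (simp only: of_nat_le_iff)
    then show ?thesis by simp
  qed
  finally have "\<bar>q ?x\<bar> \<le> b * (real n ^ 3) ^ K" using n'(5) by (intro bK) auto
  also have "\<dots> \<le> max b 0 * (real n ^ 3) ^ K" by (intro mult_right_mono) auto
  also have "\<dots> = max b 0 * real n ^ (k - 1)" by (simp add: k_def power_mult)
  also have "\<dots> < ?t choose (k + 1)"
  proof (rule power_less_choose)
    show "(k + 3) * (k + 1) \<le> n" using n'(2) by (rule order.trans[rotated]) (intro mult_left_mono, auto)
    show "max b 0 * (2 * (real k + 3) * (real k + 1)) ^ (k + 1) < real n" using n'(3) by (simp only: M_def)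
  qed (simp_all add: k_def)
  also have "\<dots> \<le> n_ineqs (F n)"
    using symmetric_formulation_size[OF F[OF n'(1)] _ l t] by (simp add: k_def)
  also have "\<dots> \<le> q ?x" using size[OF n'(1)] .
  finally show False by simp
qed

end
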